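(* For every fixed integer $k\ge 2$, there is a constant $c_k>0$ such that, for all sufficiently large integers $r$ (that is, all $r\ge r_0(k)$ for some $r_0(k)$), $$m_{\le 2k}(r)\ \ge\ c_k\, r^{-1-4/k}(\log r)^{1/k}.$$
   Context: An $r$-graph is an $r$-uniform hypergraph (a finite vertex set with a set of $r$-element subsets called edges). For fixed $k\ge 2$, $M_{\le 2k}(n,r)$ denotes the maximum number of edges in an $n$-vertex $r$-graph in which the number of edges contained in every $(r+1)$-set of vertices lies in $\{0,2,4,\ldots,2k\}$. Define $$m_{\le 2k}(r)=\lim_{n\to\infty}\frac{M_{\le 2k}(n,r)}{\binom nr}.$$ This limit exists because, by averaging over $m$-vertex subsets, the sequence $M_{\le 2k}(n,r)/\binom nr$ is nonincreasing in $n$. *)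

theory Defs
  imports "HOL-Analysis.Analysis"
begin

definition r_graph :: "nat \<Rightarrow> 'a set \<Rightarrow> 'a set set \<Rightarrow> bool" where
  "r_graph r V E \<longleftrightarrow> finite V \<and> (\<forall>e\<in>E. e \<subseteq> V \<and> card e = r)"

definition even_le :: "nat \<Rightarrow> nat \<Rightarrow> 'a set \<Rightarrow> 'a set set \<Rightarrow> bool" where
  "even_le k r V E \<longleftrightarrow>
     (\<forall>S. S \<subseteq> V \<and> card S = r + 1 \<longrightarrow> card {e \<in> E. e \<subseteq> S} \<in> {2 * i |i. i \<le> k})"

text \<open>
  \<^term>\<open>M_le k n r\<close> stands for \<open>M\<close> with index \<open>\<le> 2k\<close>: the parameter is \<open>k\<close>, the largest
  allowed count is \<open>2k\<close>. Vertices are taken in \<^typ>\<open>nat\<close>, which loses nothing, as every finite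
  hypergraph is isomorphic to one with such vertices.
\<close>

definition M_le :: "nat \<Rightarrow> nat \<Rightarrow> nat \<Rightarrow> nat" where
  "M_le k n r =
     Max {card E |(V :: nat set) E. r_graph r V E \<and> card V = n \<and> even_le k r V E}"

text \<open>
  For \<open>n < r\<close> the quotient is \<open>0 / 0 = 0\<close>, which does not affect the limit.
  The limit exists by \<open>M_le_density_LIMSEQ\<close> below.
\<close>

definition m_le :: "nat \<Rightarrow> nat \<Rightarrow> real" where
  "m_le k r = lim (\<lambda>n. real (M_le k n r) / real (n choose r))"

lemma r_graph_finite_edges:
  assumes "r_graph r V E" shows "finite E"
  by (rule finite_subset[of _ "Pow V"]) (use assms in \<open>auto simp: r_graph_def\<close>)

lemma r_graph_card_edges_le:
  assumes "r_graph r V E" shows "card E \<le> card V choose r"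
proof -
  have V: "finite V" and E: "E \<subseteq> {e. e \<subseteq> V \<and> card e = r}"
    using assms by (auto simp: r_graph_def)
  have "finite {e. e \<subseteq> V \<and> card e = r}"
    by (rule finite_subset[of _ "Pow V"]) (use V in auto)
  from card_mono[OF this E] show ?thesis by (simp only: n_subsets[OF V])
qed

lemma M_le_set:
  fixes k n r :: nat
  defines "A \<equiv> {card E |(V :: nat set) E. r_graph r V E \<and> card V = n \<and> even_le k r V E}"
  shows M_le_set_finite: "finite A" and M_le_set_nonempty: "A \<noteq> {}"
proof -
  have "A \<subseteq> {..n choose r}"
    using r_graph_card_edges_le by (auto simp: A_def)
  then show "finite A" by (rule finite_subset) simp
  have "r_graph r {..<n} {}" "even_le k r {..<n} {}"
    by (auto simp: r_graph_def even_le_def)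
  then have "card ({} :: nat set set) \<in> A" unfolding A_def
    using card_lessThan[of n] by blast
  then show "A \<noteq> {}" by blast
qed

lemma M_le_upper:
  fixes V :: "nat set"
  assumes "r_graph r V E" "even_le k r V E"
  shows "card E \<le> M_le k (card V) r"
  unfolding M_le_def by (rule Max_ge[OF M_le_set_finite]) (use assms in blast)

lemma M_le_attained:
  obtains V :: "nat set" and E
  where "r_graph r V E" "card V = n" "even_le k r V E" "card E = M_le k n r"
proof -
  have "M_le k n r \<in> {card E |(V :: nat set) E. r_graph r V E \<and> card V = n \<and> even_le k r V E}"
    unfolding M_le_def by (rule Max_in[OF M_le_set_finite M_le_set_nonempty])
  then obtain V :: "nat set" and E
    where "M_le k n r = card E" "r_graph r V E" "card V = n" "even_le k r V E" by blast
  then show thesis by (metis that)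
qed

lemma M_le_Suc:
  assumes "r \<le> n"
  shows "M_le k (Suc n) r * (Suc n - r) \<le> Suc n * M_le k n r"
proof -
  obtain V :: "nat set" and E where
    VE: "r_graph r V E" "card V = Suc n" "even_le k r V E" "card E = M_le k (Suc n) r"
    by (rule M_le_attained)
  have fin: "finite V" "finite E"
    using VE(1) r_graph_finite_edges by (auto simp: r_graph_def)
  have le: "card {e \<in> E. v \<notin> e} \<le> M_le k n r" if "v \<in> V" for v
  proof -
    have "r_graph r (V - {v}) {e \<in> E. v \<notin> e}"
      using VE(1) by (auto simp: r_graph_def)
    moreover have "even_le k r (V - {v}) {e \<in> E. v \<notin> e}"
      unfolding even_le_def
    proof (intro allI impI)
      fix S assume S: "S \<subseteq> V - {v} \<and> card S = r + 1"
      have "{e \<in> {e \<in> E. v \<notin> e}. e \<subseteq> S} = {e \<in> E. e \<subseteq> S}" using S by blast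
      moreover have "S \<subseteq> V \<and> card S = r + 1" using S by blast
      ultimately show "card {e \<in> {e \<in> E. v \<notin> e}. e \<subseteq> S} \<in> {2 * i |i. i \<le> k}"
        using VE(3) unfolding even_le_def by presburger
    qed
    ultimately have "card {e \<in> E. v \<notin> e} \<le> M_le k (card (V - {v})) r"
      by (rule M_le_upper)
    moreover have "card (V - {v}) = n" using that VE(2) fin by simp
    ultimately show ?thesis by simp
  qed
  have "card {v \<in> V. v \<notin> e} = Suc n - r" if "e \<in> E" for e
  proof -
    have "e \<subseteq> V" "card e = r" using that VE(1) by (auto simp: r_graph_def)
    moreover have "{v \<in> V. v \<notin> e} = V - e" by blast
    ultimately show ?thesis using VE(2) fin by (simp add: card_Diff_subset finite_subset)
  qed
  then have "card E * (Suc n - r) = (\<Sum>e\<in>E. card {v \<in> V. v \<notin> e})" by simp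
  also have "\<dots> = (\<Sum>v\<in>V. card {e \<in> E. v \<notin> e})"
    by (rule sum_multicount_gen[OF fin(2,1)]) simp
  also have "\<dots> \<le> Suc n * M_le k n r"
    using sum_bounded_above[of V "\<lambda>v. card {e \<in> E. v \<notin> e}" "M_le k n r"] le VE(2) by simp
  finally show ?thesis using VE(4) by simp
qed

lemma M_le_density_Suc:
  assumes "r \<le> n"
  shows "real (M_le k (Suc n) r) / real (Suc n choose r) \<le> real (M_le k n r) / real (n choose r)"
proof -
  have pos: "n choose r > 0" "Suc n choose r > 0" "Suc n - r > 0" using assms by auto
  have "(M_le k (Suc n) r * (n choose r)) * Suc n
      = M_le k (Suc n) r * (Suc n - r) * (Suc n choose r)"
    using binomial_absorb_comp[of "Suc n" r] by (simp only: diff_Suc_1 mult.assoc) (simp only: mult.commute)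
  also have "\<dots> \<le> Suc n * M_le k n r * (Suc n choose r)"
    by (rule mult_right_mono[OF M_le_Suc[OF assms]]) simp
  also have "\<dots> = (M_le k n r * (Suc n choose r)) * Suc n" by (simp only: ac_simps)
  finally have "M_le k (Suc n) r * (n choose r) \<le> M_le k n r * (Suc n choose r)"
    by (rule mult_right_le_imp_le) simp
  then have "real (M_le k (Suc n) r) * real (n choose r) \<le> real (M_le k n r) * real (Suc n choose r)"
    unfolding of_nat_mult[symmetric] of_nat_le_iff .
  then show ?thesis using pos
    by (subst pos_divide_le_eq, simp, subst times_divide_eq_left, subst pos_le_divide_eq, simp)
qed

lemma M_le_density_LIMSEQ:
  "(\<lambda>n. real (M_le k n r) / real (n choose r)) \<longlonglongrightarrow> m_le k r"
proof -
  let ?f = "\<lambda>n. real (M_le k n r) / real (n choose r)"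
  have "decseq (\<lambda>n. ?f (n + r))"
    by (rule decseq_SucI) (use M_le_density_Suc[of r] in simp)
  then have "convergent (\<lambda>n. ?f (n + r))"
    by (rule decseq_convergent[where B = 0]) (auto intro: convergentI)
  then have "convergent ?f" using convergent_ignore_initial_segment[of ?f r] by blast
  then show ?thesis by (simp add: m_le_def convergent_LIMSEQ_iff)
qed

end

theory Submission
  imports Defs "HOL-Computational_Algebra.Primes" "HOL-Real_Asymp.Real_Asymp"
begin

text \<open>
  Take \<open>E\<close> to be the mod 2 coboundary of a family \<open>H\<close> of \<open>(r-1)\<close>-sets. For an \<open>(r+1)\<close>-set \<open>S\<close>,
  join \<open>x, y \<in> S\<close> when \<open>S - {x, y} \<in> H\<close>; the edges of \<open>E\<close> inside \<open>S\<close> correspond to the vertices of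
  odd degree in this graph, so their number is even.

  Label the vertices by random \<open>u x \<in> {0..<q}\<close>, \<open>q\<close> prime, and let \<open>H\<close> prescribe the sums of \<open>u x\<close>
  and of \<open>(u x)\<^sup>2\<close> modulo \<open>q\<close>. The points \<open>(u, u\<^sup>2)\<close> form a Sidon set, so all edges of the graph on \<open>S\<close>
  join the same two label classes. Allowing at most \<open>t\<close> equal labels in members of \<open>H\<close> leaves at most
  \<open>2 t + 2\<close> odd vertices, and this restriction is harmless as soon as \<open>q\<^sup>t\<close> exceeds \<open>r\<^bsup>t+1\<^esup>\<close> by a constant
  factor. With \<open>t = k - 1\<close> the resulting density, up to logarithms \<open>r / q\<^sup>2 = r\<^bsup>-1-2/(k-1)\<^esup>\<close>, suffices for \<open>k \<ge> 3\<close>.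

  For \<open>k = 2\<close> one needs \<open>t = 2\<close>, and the only obstruction is a graph with six odd vertices inside a
  \<open>K\<^bsub>3,3\<^esub>\<close>. It is destroyed by second random labels \<open>c x < 2\<^sup>h\<close>: \<open>H\<close> also prescribes, modulo \<open>h\<close>, the sum of
  the 2-adic valuations of \<open>c x - c y\<close> over the pairs with equal \<open>u\<close>. Among three points exactly two of
  the three valuations agree, which forces a vertex of even degree. This costs only a factor
  \<open>h = O(log r)\<close>.
\<close>

subsection \<open>Primes in intervals\<close>

text \<open>
  By the recursion \<open>1/a(n,k+1) = 1/a(n-1,k) - 1/a(n,k)\<close> of Leibniz' triangle,
  where \<open>a(n,k) = (n+1) binom(n,k)\<close>.
\<close>

lemma Suc_mult_binomial_dvd:
  assumes "k \<le> n" "\<And>i. 1 \<le> i \<Longrightarrow> i \<le> Suc n \<Longrightarrow> i dvd L"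
  shows "Suc n * (n choose k) dvd L"
proof -
  \<comment> \<open>Divisibility is rephrased as integrality of a quotient, so that the recursion
    becomes a difference of two integers.\<close>
  have "real L / (real (Suc n) * real (n choose k)) \<in> \<int>"
    using assms
  proof (induction k arbitrary: n)
    case 0
    then have "Suc n dvd L" by simp
    then obtain j where "L = Suc n * j" by (rule dvdE)
    then have "real L / (real (Suc n) * real (n choose 0)) = real j" by (simp add: field_simps)
    then show ?case by simp
  next
    case (Suc k)
    then obtain m where n: "n = Suc m" by (cases n) auto
    have 1: "real L / (real (Suc m) * real (m choose k)) \<in> \<int>"
      using Suc.prems n by (intro Suc.IH) auto
    have 2: "real L / (real (Suc n) * real (n choose k)) \<in> \<int>"
      using Suc.prems by (intro Suc.IH) auto
    have pos: "real (n choose Suc k) > 0" "real (n choose k) > 0" "real (m choose k) > 0"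
      using Suc.prems n by (simp_all del: binomial_Suc_Suc)
    have a: "real (Suc k) * real (n choose Suc k) = real n * real (m choose k)"
      using Suc_times_binomial_eq[of m k] unfolding n by (metis mult.commute of_nat_mult)
    have "(Suc n choose Suc k) * Suc k = Suc n * (n choose k)"
      using Suc_times_binomial_eq[of n k] by simp
    then have "((n choose k) + (n choose Suc k)) * Suc k = Suc n * (n choose k)"
      by simp
    then have b: "(real (n choose k) + real (n choose Suc k)) * real (Suc k) = real (Suc n) * real (n choose k)"
      by (metis of_nat_add of_nat_mult)
    have "1 / (real n * real (m choose k)) - 1 / (real (Suc n) * real (n choose k))
        = 1 / (real (Suc k) * real (n choose Suc k))
          - 1 / ((real (n choose k) + real (n choose Suc k)) * real (Suc k))"
      by (simp only: a b)
    also have "\<dots> = real (n choose k) / ((real (n choose k) + real (n choose Suc k)) * real (Suc k) * real (n choose Suc k))"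
      using pos add_pos_pos[OF pos(2,1)] by (simp add: divide_simps)
    also have "\<dots> = 1 / (real (Suc n) * real (n choose Suc k))"
      unfolding b using pos by (simp add: divide_simps)
    finally have "real L * (1 / (real n * real (m choose k)) - 1 / (real (Suc n) * real (n choose k)))
        = real L * (1 / (real (Suc n) * real (n choose Suc k)))" by simp
    then have "real L / (real n * real (m choose k)) - real L / (real (Suc n) * real (n choose k))
        = real L / (real (Suc n) * real (n choose Suc k))"
      by (simp add: right_diff_distrib)
    then show ?case using Ints_diff[OF 1 2] n by simp
  qed
  then obtain z where z: "real L / (real (Suc n) * real (n choose k)) = of_int z"
    by (auto elim: Ints_cases)
  have pos: "real (Suc n) * real (n choose k) > 0" using assms by auto
  then have "real L = of_int z * (real (Suc n) * real (n choose k))"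
    using z by (simp add: field_simps)
  then have "int L = z * int (Suc n * (n choose k))"
    by (metis of_int_eq_iff of_int_mult of_int_of_nat_eq of_nat_mult)
  then have "int (Suc n * (n choose k)) dvd int L" by simp
  then show ?thesis by (simp only: of_nat_dvd_iff)
qed

text \<open>Nair's argument: \<open>L\<close> is the least common multiple of 1, ..., 2n + 1. It is
  a multiple of (2n + 1) binom(2n, n), which is at least 4^n, while each of its maximal prime powers
  is at most 2n + 1.\<close>

lemma four_pow_le_pow_card_primes:
  assumes "n > 0"
  shows "4 ^ n \<le> (2 * n + 1) ^ card {p::nat. prime p \<and> p \<le> 2 * n + 1}"
proof -
  define m where "m = 2 * n + 1"
  define P where "P = {p::nat. prime p \<and> p \<le> m}"
  define f where "f p = Max {e. p ^ e \<le> m}" for p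
  define L where "L = (\<Prod>p\<in>P. p ^ f p)"
  have fin: "finite P" unfolding P_def by simp
  have m: "m \<ge> 1" by (simp add: m_def)
  have fs: "finite {e. p ^ e \<le> m}" if "prime p" for p
  proof (rule finite_subset)
    show "{e. p ^ e \<le> m} \<subseteq> {..m}"
    proof clarsimp
      fix e assume "p ^ e \<le> m"
      moreover have "e < p ^ e" using prime_gt_1_nat[OF that] by (intro power_gt_expt) simp
      ultimately show "e \<le> m" by simp
    qed
  qed simp
  have fle: "p ^ f p \<le> m" if "prime p" for p
  proof -
    have "f p \<in> {e. p ^ e \<le> m}" unfolding f_def
      by (rule Max_in[OF fs[OF that]]) (use m in \<open>auto intro: exI[of _ 0]\<close>)
    then show ?thesis by simp
  qed
  have Lpos: "L > 0" unfolding L_def using P_def by (auto intro!: prod_pos simp: prime_gt_0_nat)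
  have dvd: "i dvd L" if "1 \<le> i" "i \<le> m" for i
  proof (rule multiplicity_le_imp_dvd)
    fix p :: nat assume p: "prime p"
    show "multiplicity p i \<le> multiplicity p L"
    proof (cases "p dvd i")
      case True
      then have "p \<in> P" using p that dvd_imp_le[of p i] by (auto simp: P_def)
      have "p ^ multiplicity p i \<le> m"
        using that dvd_imp_le[OF multiplicity_dvd[of p i]] by simp
      then have "multiplicity p i \<le> f p" unfolding f_def by (intro Max_ge fs p) simp
      also have "\<dots> = multiplicity p L" unfolding L_def
        by (subst multiplicity_prod_prime_powers) (use fin p \<open>p \<in> P\<close> in \<open>auto simp: P_def\<close>)
      finally show ?thesis .
    qed (simp add: not_dvd_imp_multiplicity_0)
  qed (use that in simp)
  have "Suc (2 * n) * (2 * n choose n) dvd L"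
    by (rule Suc_mult_binomial_dvd) (use dvd in \<open>auto simp: m_def\<close>)
  then have "Suc (2 * n) * (2 * n choose n) \<le> L" using Lpos by (rule dvd_imp_le)
  also have "L \<le> (\<Prod>p\<in>P. m)" unfolding L_def
    by (rule prod_mono) (use fle in \<open>auto simp: P_def\<close>)
  finally have *: "Suc (2 * n) * (2 * n choose n) \<le> m ^ card P" by simp
  have "real (4 ^ n) \<le> real (2 * n * (2 * n choose n))"
    using central_binomial_lower_bound[OF assms] assms by (simp add: field_simps)
  then have "4 ^ n \<le> 2 * n * (2 * n choose n)" by (simp only: of_nat_le_iff)
  with * show ?thesis unfolding P_def m_def by simp
qed

text \<open>If no prime lay above \<open>A\<close> and up to \<open>B\<close>, there would be at
  most \<open>A\<close> primes up to \<open>B\<close>, and the preceding bound would make 2^(B - 2)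
  at most B^A.\<close>

lemma prime_between:
  assumes "B ^ A < 2 ^ (B - 2)" "B \<ge> 3"
  obtains p :: nat where "prime p" "A < p" "p \<le> B"
proof (rule ccontr)
  assume "\<not> thesis"
  then have no: "\<not> (prime p \<and> A < p \<and> p \<le> B)" for p :: nat using that by blast
  \<comment> \<open>2n + 1 is the largest odd number not exceeding \<open>B\<close>; this rounding
    is why the exponent is B - 2.\<close>
  define n where "n = (B - 1) div 2"
  have n: "n > 0" "2 * n + 1 \<le> B" "B - 2 \<le> 2 * n" using assms(2) by (auto simp: n_def)
  have "{p::nat. prime p \<and> p \<le> 2 * n + 1} \<subseteq> {1..A}"
  proof clarify
    fix p :: nat assume "prime p" "p \<le> 2 * n + 1"
    then show "p \<in> {1..A}" using no[of p] n(2) prime_gt_0_nat[of p] by auto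
  qed
  then have c: "card {p::nat. prime p \<and> p \<le> 2 * n + 1} \<le> A"
    using card_mono[of "{1..A}"] by fastforce
  have "2 ^ (B - 2) \<le> (2::nat) ^ (2 * n)" using n(3) by simp
  also have "\<dots> = 4 ^ n" by (simp add: power_mult)
  also have "\<dots> \<le> (2 * n + 1) ^ card {p::nat. prime p \<and> p \<le> 2 * n + 1}"
    by (rule four_pow_le_pow_card_primes[OF n(1)])
  also have "\<dots> \<le> (2 * n + 1) ^ A" using c by (intro power_increasing) auto
  also have "\<dots> \<le> B ^ A" using n(2) by (rule power_mono) simp
  finally show False using assms(1) by simp
qed

subsection \<open>Coboundaries and odd vertices\<close>

definition coboundary :: "nat \<Rightarrow> 'a set \<Rightarrow> 'a set set \<Rightarrow> 'a set set" where
  "coboundary r V H = {e. e \<subseteq> V \<and> card e = r \<and> odd (card {x \<in> e. e - {x} \<in> H})}"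

text \<open>The neighbourhood of \<open>x\<close> in the graph on \<open>S\<close> whose edges are
  the pairs with complement in \<open>H\<close>.\<close>

definition co_neighbours :: "'a set set \<Rightarrow> 'a set \<Rightarrow> 'a \<Rightarrow> 'a set" where
  "co_neighbours H S x = {y \<in> S. y \<noteq> x \<and> S - {x, y} \<in> H}"

definition odd_vertices :: "'a set set \<Rightarrow> 'a set \<Rightarrow> 'a set" where
  "odd_vertices H S = {x \<in> S. odd (card (co_neighbours H S x))}"

lemma co_neighbours_sym: "x \<in> S \<Longrightarrow> y \<in> co_neighbours H S x \<Longrightarrow> x \<in> co_neighbours H S y"
  by (auto simp: co_neighbours_def insert_commute)

lemma co_neighbours_of_odd:
  assumes "x \<in> odd_vertices H S" shows "\<exists>y. y \<in> co_neighbours H S x"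
proof -
  have "co_neighbours H S x \<noteq> {}" using assms unfolding odd_vertices_def by fastforce
  then show ?thesis by blast
qed

text \<open>An edge inside \<open>S\<close> is \<open>S - {x}\<close> for a unique \<open>x\<close>,
  and its subsets \<open>S - {x, y}\<close> lying in \<open>H\<close> correspond to the neighbours
  \<open>y\<close> of \<open>x\<close>. So \<open>S - {x}\<close> is an edge exactly when
  \<open>x\<close> has odd degree.\<close>

lemma card_coboundary:
  assumes "finite S" "S \<subseteq> V" "card S = r + 1"
  shows "card {e \<in> coboundary r V H. e \<subseteq> S} = card (odd_vertices H S)"
proof -
  have nb: "{y \<in> S. y \<noteq> x \<and> S - {x} - {y} \<in> H} = co_neighbours H S x" for x
    unfolding co_neighbours_def by (simp add: Diff_insert[symmetric] insert_commute conj_assoc)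
  have "bij_betw (\<lambda>x. S - {x}) (odd_vertices H S) {e \<in> coboundary r V H. e \<subseteq> S}"
    unfolding bij_betw_def
  proof
    show "inj_on (\<lambda>x. S - {x}) (odd_vertices H S)"
      by (auto simp: inj_on_def odd_vertices_def)
    show "(\<lambda>x. S - {x}) ` odd_vertices H S = {e \<in> coboundary r V H. e \<subseteq> S}" (is "?l = ?r")
    proof
      show "?l \<subseteq> ?r" using assms by (auto simp: odd_vertices_def coboundary_def nb)
      show "?r \<subseteq> ?l"
      proof
        fix e assume e: "e \<in> ?r"
        then have "card (S - e) = 1"
          using assms by (subst card_Diff_subset) (auto simp: coboundary_def intro: finite_subset)
        then obtain x where x: "S - e = {x}" by (rule card_1_singletonE)
        then have ex: "e = S - {x}" "x \<in> S" using e by auto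
        then show "e \<in> ?l" using e by (auto simp: odd_vertices_def coboundary_def nb)
      qed
    qed
  qed
  from bij_betw_same_card[OF this] show ?thesis by simp
qed

text \<open>Handshake lemma. The linear order splits the ordered pairs of adjacent vertices into
  \<open>L\<close> and its mirror image, so the degree sum is even.\<close>

lemma even_card_odd_vertices:
  fixes S :: "'a::linorder set"
  assumes "finite S" shows "even (card (odd_vertices H S))"
proof -
  define L where "L = {(x, y). x \<in> S \<and> y \<in> co_neighbours H S x \<and> x < y}"
  have fL: "finite L"
    by (rule finite_subset[of _ "S \<times> S"]) (use assms in \<open>auto simp: L_def co_neighbours_def\<close>)
  have "(\<Sum>x\<in>S. card (co_neighbours H S x)) = card (SIGMA x:S. co_neighbours H S x)"
    using assms by (simp add: co_neighbours_def)
  also have "(SIGMA x:S. co_neighbours H S x) = L \<union> prod.swap ` L"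
  proof -
    have *: "(y, x) \<in> L" if "x \<in> S" "y \<in> co_neighbours H S x" "y < x" for x y
      using that co_neighbours_sym[of x S y H] by (auto simp: L_def co_neighbours_def)
    show ?thesis
    proof (intro equalityI subsetI)
      fix z assume "z \<in> (SIGMA x:S. co_neighbours H S x)"
      then obtain x y where z: "z = (x, y)" "x \<in> S" "y \<in> co_neighbours H S x" by blast
      then have "x < y \<or> y < x" by (auto simp: co_neighbours_def)
      then show "z \<in> L \<union> prod.swap ` L"
      proof
        assume "y < x"
        from *[OF z(2,3) this] show ?thesis unfolding z(1) by force
      qed (use z in \<open>simp add: L_def\<close>)
    next
      fix z assume "z \<in> L \<union> prod.swap ` L"
      then obtain x y where "x \<in> S" "y \<in> co_neighbours H S x" "z = (x, y) \<or> z = (y, x)" by (auto simp: L_def)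
      then show "z \<in> (SIGMA x:S. co_neighbours H S x)"
        using co_neighbours_sym[of x S y H] by (auto simp: co_neighbours_def)
    qed
  qed
  also have "card \<dots> = card L + card (prod.swap ` L)"
    by (rule card_Un_disjoint) (use fL in \<open>auto simp: L_def\<close>)
  also have "card (prod.swap ` L) = card L" by (rule card_image) simp
  finally have "even (\<Sum>x\<in>S. card (co_neighbours H S x))" by simp
  then show ?thesis unfolding odd_vertices_def by (subst (asm) even_sum_iff[OF assms])
qed

section \<open>The Sidon property of the parabola modulo an odd prime\<close>

text \<open>Eliminating \<open>b\<close> from the two congruences gives 2 (a - a') (a - b') = 0
  modulo the odd prime \<open>q\<close>. Hence \<open>a\<close> is congruent to \<open>a'\<close> or
  \<open>b'\<close>, the sum determines the other label, and the bounds turn congruence into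
  equality.\<close>

lemma sidon_parabola:
  fixes q a b a' b' :: nat
  assumes q: "prime q" "q > 2" and lt: "a < q" "b < q" "a' < q" "b' < q"
    and s: "int q dvd (int a + int b) - (int a' + int b')"
    and s2: "int q dvd ((int a)\<^sup>2 + (int b)\<^sup>2) - ((int a')\<^sup>2 + (int b')\<^sup>2)"
  shows "{a, b} = {a', b'}"
proof -
  have pq: "prime (int q)" using q by simp
  have eqI: "x = y" if "x < q" "y < q" "int q dvd int x - int y" for x y
    using that by (simp add: mod_eq_dvd_iff[symmetric])
  have "int q dvd ((int a)\<^sup>2 + (int b)\<^sup>2) - ((int a')\<^sup>2 + (int b')\<^sup>2)
      - ((int a + int b) - (int a' + int b')) * (int b + int a' + int b' - int a)"
    by (intro dvd_diff s2 dvd_mult2 s)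
  also have "\<dots> = 2 * ((int a - int a') * (int a - int b'))"
    by (simp add: algebra_simps power2_eq_square)
  finally have "int q dvd 2 * ((int a - int a') * (int a - int b'))" .
  moreover have "\<not> int q dvd 2" using q zdvd_imp_le[of "int q" 2] by auto
  ultimately have "int q dvd int a - int a' \<or> int q dvd int a - int b'"
    using pq by (simp add: prime_dvd_mult_iff)
  then show ?thesis
  proof
    assume d: "int q dvd int a - int a'"
    then have "int q dvd int b - int b'" using dvd_diff[OF s d] by (simp add: algebra_simps)
    then show ?thesis using eqI d lt by auto
  next
    assume d: "int q dvd int a - int b'"
    then have "int q dvd int b - int a'" using dvd_diff[OF s d] by (simp add: algebra_simps)
    then show ?thesis using eqI d lt by auto
  qed
qed

subsection \<open>Families of labelled sets\<close>

text \<open>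
  The value matters only when \<open>Z\<close> has two elements, where it is the 2-adic valuation of the difference
  of their labels.
\<close>

definition split_level :: "(nat \<Rightarrow> nat) \<Rightarrow> nat set \<Rightarrow> nat" where
  "split_level c Z = multiplicity 2 (int (c (Max Z)) - int (c (Min Z)))"

text \<open>The first condition limits repetitions of \<open>u\<close>. The second makes
  \<open>c\<close> separate points with equal \<open>u\<close>, so that the differences entering
  \<open>split_level\<close> for pairs are nonzero.\<close>

definition well_labelled :: "nat \<Rightarrow> (nat \<Rightarrow> nat) \<Rightarrow> (nat \<Rightarrow> nat) \<Rightarrow> nat set \<Rightarrow> bool" where
  "well_labelled t u c f \<longleftrightarrow> (\<forall>i. card {x \<in> f. u x = i} \<le> t) \<and>
     (\<forall>x\<in>f. \<forall>y\<in>f. x \<noteq> y \<longrightarrow> u x = u y \<longrightarrow> c x \<noteq> c y)"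

text \<open>The first two components are the coordinates of the sum of the points (u, u^2) modulo
  \<open>q\<close>. The third serves the case \<open>t = 2\<close>, where each class of equal labels
  in a well-labelled set has at most two points.\<close>

definition label_key :: "nat \<Rightarrow> nat \<Rightarrow> (nat \<Rightarrow> nat) \<Rightarrow> (nat \<Rightarrow> nat) \<Rightarrow> nat set \<Rightarrow> nat \<times> nat \<times> nat" where
  "label_key q h u c f = ((\<Sum>x\<in>f. u x) mod q, (\<Sum>x\<in>f. (u x)\<^sup>2) mod q,
     (\<Sum>i<q. split_level c {x \<in> f. u x = i}) mod h)"

definition key_family :: "nat \<Rightarrow> nat \<Rightarrow> nat \<Rightarrow> (nat \<Rightarrow> nat) \<Rightarrow> (nat \<Rightarrow> nat) \<Rightarrow> nat \<times> nat \<times> nat \<Rightarrow> nat set set" where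
  "key_family t q h u c K = {f. well_labelled t u c f \<and> label_key q h u c f = K}"

section \<open>2-adic valuations of label differences\<close>

lemma split_level_doubleton:
  assumes "a \<noteq> b"
  shows "split_level c {a, b} = multiplicity 2 (int (c a) - int (c b))"
proof (cases "a < b")
  case True
  then have "split_level c {a, b} = multiplicity 2 (int (c b) - int (c a))" by (simp add: split_level_def)
  then show ?thesis
    using multiplicity_times_unit_right[of "- 1" 2 "int (c b) - int (c a)"] by simp
next
  case False
  with assms show ?thesis by (simp add: split_level_def max_def min_def)
qed

text \<open>A nonzero integer of absolute value below 2^h is not divisible by 2^h. Thus the level of
  such a pair is determined by its residue modulo \<open>h\<close>.\<close>

lemma split_level_doubleton_less:
  assumes "a \<noteq> b" "c a \<noteq> c b" "c a < 2 ^ h" "c b < 2 ^ h"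
  shows "split_level c {a, b} < h"
proof (rule ccontr)
  assume "\<not> split_level c {a, b} < h"
  then have "2 ^ h dvd int (c a) - int (c b)"
    unfolding split_level_doubleton[OF assms(1)] by (intro multiplicity_dvd') simp
  moreover have "int (c a) < 2 ^ h" "int (c b) < 2 ^ h"
    using assms(3,4) by (metis of_nat_less_iff of_nat_numeral of_nat_power)+
  then have "\<bar>int (c a) - int (c b)\<bar> < 2 ^ h" by linarith
  ultimately show False using zdvd_imp_le[of "2 ^ h" "\<bar>int (c a) - int (c b)\<bar>"] assms(2) by fastforce
qed

text \<open>If the valuations differ, the sum has the smaller one. If they agree, the odd cofactors
  have an even sum, so the valuation strictly increases; this second case is special to the prime
  2.\<close>

lemma multiplicity_2_ultrametric:
  fixes p q :: int
  assumes "p \<noteq> 0" "q \<noteq> 0" "p + q \<noteq> 0"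
  shows "(multiplicity 2 p = multiplicity 2 q \<and> multiplicity 2 (p + q) \<noteq> multiplicity 2 p) \<or>
    (multiplicity 2 p = multiplicity 2 (p + q) \<and> multiplicity 2 q \<noteq> multiplicity 2 p) \<or>
    (multiplicity 2 q = multiplicity 2 (p + q) \<and> multiplicity 2 p \<noteq> multiplicity 2 q)"
proof -
  have dvd: "2 ^ n dvd x \<longleftrightarrow> n \<le> multiplicity 2 x" if "x \<noteq> 0" for x :: int and n
    using that by (intro power_dvd_iff_le_multiplicity) auto
  have less: "multiplicity 2 (a + b) = multiplicity 2 a"
    if "multiplicity 2 a < multiplicity 2 b" "a \<noteq> 0" "b \<noteq> 0" "a + b \<noteq> 0" for a b :: int
  proof -
    have "2 ^ multiplicity 2 a dvd a + b"
      using that dvd by (intro dvd_add) auto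
    moreover have "\<not> 2 ^ Suc (multiplicity 2 a) dvd a + b"
    proof
      assume "2 ^ Suc (multiplicity 2 a) dvd a + b"
      moreover have "2 ^ Suc (multiplicity 2 a) dvd b" using that dvd[of b "Suc (multiplicity 2 a)"] by simp
      ultimately have "2 ^ Suc (multiplicity 2 a) dvd a" using dvd_add_left_iff by blast
      then show False unfolding dvd[OF that(2)] by simp
    qed
    ultimately show ?thesis using dvd[OF that(4)] by (metis le_antisym not_less_eq_eq)
  qed
  consider "multiplicity 2 p < multiplicity 2 q" | "multiplicity 2 q < multiplicity 2 p"
    | "multiplicity 2 p = multiplicity 2 q" by linarith
  then show ?thesis
  proof cases
    case 1
    then show ?thesis using less[OF 1] assms by simp
  next
    case 2
    then show ?thesis using less[OF 2] assms by (simp add: add.commute)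
  next
    case 3
    define n where "n = multiplicity 2 p"
    obtain a where a: "p = 2 ^ n * a" using multiplicity_dvd[of 2 p] n_def by auto
    obtain b where b: "q = 2 ^ n * b" using multiplicity_dvd[of 2 q] n_def 3 by auto
    have "odd a"
    proof
      assume "even a" then have "2 ^ Suc n dvd p" unfolding a by auto
      then show False using dvd[OF assms(1), of "Suc n"] n_def by simp
    qed
    moreover have "odd b"
    proof
      assume "even b" then have "2 ^ Suc n dvd q" unfolding b by auto
      then show False using dvd[OF assms(2), of "Suc n"] n_def 3 by simp
    qed
    ultimately have "even (a + b)" by simp
    then have "2 ^ Suc n dvd p + q" unfolding a b by (auto simp: distrib_left[symmetric])
    then show ?thesis using dvd[OF assms(3), of "Suc n"] 3 n_def by simp
  qed
qed

text \<open>The three differences of labels have the form p, q, p + q, so exactly two of their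
  valuations agree. Each pair is indexed by the point of \<open>X\<close> that it omits.\<close>

lemma split_levels_of_triple:
  assumes "card X = 3" "inj_on c X"
  obtains x y z where "X = {x, y, z}" "x \<noteq> y" "x \<noteq> z" "y \<noteq> z"
    "split_level c (X - {x}) = split_level c (X - {y})" "split_level c (X - {z}) \<noteq> split_level c (X - {x})"
proof -
  obtain x y z where X: "X = {x, y, z}" "x \<noteq> y" "x \<noteq> z" "y \<noteq> z"
    using assms(1) by (auto simp: card_3_iff)
  have d: "c x \<noteq> c y" "c x \<noteq> c z" "c y \<noteq> c z"
    using assms(2) X by (auto simp: inj_on_def)
  let ?p = "int (c x) - int (c y)" and ?q = "int (c y) - int (c z)"
  have rem: "X - {x} = {y, z}" "X - {y} = {x, z}" "X - {z} = {x, y}" using X by auto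
  have t: "split_level c (X - {x}) = multiplicity 2 ?q" "split_level c (X - {y}) = multiplicity 2 (?p + ?q)"
    "split_level c (X - {z}) = multiplicity 2 ?p"
    unfolding rem using X by (simp_all add: split_level_doubleton)
  consider "multiplicity 2 ?p = multiplicity 2 ?q" "multiplicity 2 (?p + ?q) \<noteq> multiplicity 2 ?p"
    | "multiplicity 2 ?p = multiplicity 2 (?p + ?q)" "multiplicity 2 ?q \<noteq> multiplicity 2 ?p"
    | "multiplicity 2 ?q = multiplicity 2 (?p + ?q)" "multiplicity 2 ?p \<noteq> multiplicity 2 ?q"
    using multiplicity_2_ultrametric[of ?p ?q] d by auto
  then show thesis
  proof cases
    case 1 then show thesis using X t by (intro that[of x z y]) auto
  next
    case 2 then show thesis using X t by (intro that[of y z x]) auto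
  next
    case 3 then show thesis using X t by (intro that[of x y z]) auto
  qed
qed

lemma sum_remove_pair:
  fixes g :: "nat \<Rightarrow> nat"
  assumes "finite S" "x \<in> S" "y \<in> S" "x \<noteq> y"
  shows "sum g S = sum g (S - {x, y}) + (g x + g y)"
  using sum.subset_diff[of "{x, y}" S g] assms by simp

section \<open>Edges of the graph on an (r+1)-set and their label classes\<close>

text \<open>Deleting the ends of an edge leaves a well-labelled set, so a class can exceed
  \<open>t\<close> only through the ends it contains.\<close>

lemma edge_class_card:
  assumes fin: "finite S" and xy: "x \<in> S" "y \<in> co_neighbours (key_family t q h u c K) S x"
  shows "card {z \<in> S. u z = i} \<le> t + card {z \<in> {x, y}. u z = i}"
proof -
  have "{z \<in> S. u z = i} \<subseteq> {z \<in> S - {x, y}. u z = i} \<union> {z \<in> {x, y}. u z = i}" by blast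
  then have "card {z \<in> S. u z = i} \<le> card ({z \<in> S - {x, y}. u z = i} \<union> {z \<in> {x, y}. u z = i})"
    by (intro card_mono) (use fin in auto)
  also have "\<dots> \<le> card {z \<in> S - {x, y}. u z = i} + card {z \<in> {x, y}. u z = i}" by (rule card_Un_le)
  also have "card {z \<in> S - {x, y}. u z = i} \<le> t"
    using xy by (simp add: co_neighbours_def key_family_def well_labelled_def)
  finally show ?thesis by simp
qed

text \<open>Suppose two points of \<open>X\<close> had the same \<open>c\<close>. The third point of
  \<open>X\<close> is odd, hence has an edge, whose other end lies in \<open>Y\<close>. Deleting
  this edge would leave both points in a well-labelled set, which is impossible.\<close>

lemma odd_vertices_imp_inj:
  assumes "odd_vertices (key_family 2 q h u c K) S = X \<union> Y" "card X = 3"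
    and X: "X = {z \<in> S. u z = i}" and Y: "Y = {z \<in> S. u z = j}"
    and nb: "\<And>x y. x \<in> X \<Longrightarrow> y \<in> co_neighbours (key_family 2 q h u c K) S x \<Longrightarrow> y \<in> Y"
    and ij: "i \<noteq> j"
  shows "inj_on c X"
proof (rule inj_onI, rule ccontr)
  fix z w assume zw: "z \<in> X" "w \<in> X" "c z = c w" "z \<noteq> w"
  have fX: "finite X" using assms(2) by (simp add: card_ge_0_finite)
  have "card (X - {z, w}) = 1" using zw assms(2) fX by (subst card_Diff_subset) auto
  then obtain x where x: "x \<in> X" "x \<noteq> z" "x \<noteq> w" by (auto simp: card_1_singleton_iff)
  then have "x \<in> odd_vertices (key_family 2 q h u c K) S" using assms(1) by blast
  then obtain y where y: "y \<in> co_neighbours (key_family 2 q h u c K) S x" using co_neighbours_of_odd[of x] by blast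
  then have "y \<in> Y" using nb x by blast
  then have "z \<in> S - {x, y}" "w \<in> S - {x, y}" using zw x ij by (auto simp: X Y)
  moreover have "well_labelled 2 u c (S - {x, y})" using y by (simp add: co_neighbours_def key_family_def)
  moreover have "u z = u w" using zw X by simp
  ultimately show False using zw(3,4) unfolding well_labelled_def by blast
qed

context
  fixes t q h :: nat and u c :: "nat \<Rightarrow> nat" and K :: "nat \<times> nat \<times> nat" and S :: "nat set"
  assumes q: "prime q" "q > 2" and fin: "finite S" and uq: "\<And>x. x \<in> S \<Longrightarrow> u x < q"
begin

text \<open>The complements of the two edges have the same key, so the sums of \<open>u\<close> and
  of its square over the two edges agree modulo \<open>q\<close>, and the Sidon property
  applies.\<close>

lemma edge_labels:
  assumes "x \<in> S" "y \<in> co_neighbours (key_family t q h u c K) S x" "x' \<in> S" "y' \<in> co_neighbours (key_family t q h u c K) S x'"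
  shows "{u x, u y} = {u x', u y'}"
proof (rule sidon_parabola[OF q])
  have *: "x \<in> S" "y \<in> S" "x \<noteq> y" "x' \<in> S" "y' \<in> S" "x' \<noteq> y'"
    using assms by (auto simp: co_neighbours_def)
  show "u x < q" "u y < q" "u x' < q" "u y' < q" using * uq by auto
  have dvd: "int q dvd (int (g x) + int (g y)) - (int (g x') + int (g y'))"
    if "sum g (S - {x, y}) mod q = sum g (S - {x', y'}) mod q" for g :: "nat \<Rightarrow> nat"
  proof -
    have "int q dvd int (sum g (S - {x', y'})) - int (sum g (S - {x, y}))"
      using that by (metis mod_eq_dvd_iff of_nat_mod)
    moreover have "int (sum g (S - {x', y'})) - int (sum g (S - {x, y}))
        = (int (g x) + int (g y)) - (int (g x') + int (g y'))"
      using sum_remove_pair[OF fin *(1-3), of g] sum_remove_pair[OF fin *(4-6), of g] by linarith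
    ultimately show ?thesis by simp
  qed
  have "label_key q h u c (S - {x, y}) = label_key q h u c (S - {x', y'})"
    using assms by (auto simp: co_neighbours_def key_family_def)
  then have e: "sum u (S - {x, y}) mod q = sum u (S - {x', y'}) mod q"
    "sum (\<lambda>x. (u x)\<^sup>2) (S - {x, y}) mod q = sum (\<lambda>x. (u x)\<^sup>2) (S - {x', y'}) mod q"
    by (simp_all add: label_key_def)
  show "int q dvd int (u x) + int (u y) - (int (u x') + int (u y'))" by (rule dvd[OF e(1)])
  show "int q dvd (int (u x))\<^sup>2 + (int (u y))\<^sup>2 - ((int (u x'))\<^sup>2 + (int (u y'))\<^sup>2)"
    using dvd[OF e(2)] by simp
qed

lemma odd_vertices_subset:
  assumes "x \<in> S" "y \<in> co_neighbours (key_family t q h u c K) S x"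
  shows "odd_vertices (key_family t q h u c K) S \<subseteq> {z \<in> S. u z = u x} \<union> {z \<in> S. u z = u y}"
proof
  fix z assume z: "z \<in> odd_vertices (key_family t q h u c K) S"
  then obtain w where "w \<in> co_neighbours (key_family t q h u c K) S z" using co_neighbours_of_odd[OF z] by blast
  moreover have zS: "z \<in> S" using z by (simp add: odd_vertices_def)
  ultimately have "u z \<in> {u x, u y}" using edge_labels[OF assms, of z w] by blast
  then show "z \<in> {z \<in> S. u z = u x} \<union> {z \<in> S. u z = u y}" using zS by blast
qed

text \<open>Every odd vertex lies in one of the label classes of the ends of one fixed edge. Two
  different classes have at most t + 1 points each; a single class has at most t + 2.\<close>

lemma card_odd_vertices_le: "card (odd_vertices (key_family t q h u c K) S) \<le> 2 * t + 2"
proof (cases "odd_vertices (key_family t q h u c K) S = {}")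
  case False
  then obtain x where x: "x \<in> odd_vertices (key_family t q h u c K) S" by blast
  then have xS: "x \<in> S" by (simp add: odd_vertices_def)
  obtain y where y: "y \<in> co_neighbours (key_family t q h u c K) S x" using co_neighbours_of_odd[OF x] by blast
  have "card (odd_vertices (key_family t q h u c K) S) \<le> card ({z \<in> S. u z = u x} \<union> {z \<in> S. u z = u y})"
    by (rule card_mono[OF _ odd_vertices_subset[OF xS y]]) (use fin in auto)
  also have "\<dots> \<le> 2 * t + 2"
  proof (cases "u x = u y")
    case True
    have "card {z \<in> {x, y}. u z = u x} \<le> card {x, y}" by (intro card_mono) auto
    also have "\<dots> \<le> 2" by (simp add: card_insert_if)
    finally have "card {z \<in> S. u z = u x} \<le> t + 2" using edge_class_card[OF fin xS y, of "u x"] by linarith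
    then show ?thesis unfolding True[symmetric] Un_absorb by linarith
  next
    case False
    then have "{z \<in> {x, y}. u z = u x} = {x}" "{z \<in> {x, y}. u z = u y} = {y}" by auto
    then have "card {z \<in> S. u z = u x} \<le> t + 1" "card {z \<in> S. u z = u y} \<le> t + 1"
      using edge_class_card[OF fin xS y, of "u x"] edge_class_card[OF fin xS y, of "u y"]
      by (simp_all only: card_insert_if finite.emptyI card.empty if_False empty_iff One_nat_def)
    then show ?thesis
      using card_Un_le[of "{z \<in> S. u z = u x}" "{z \<in> S. u z = u y}"]
      by linarith
  qed
  finally show ?thesis .
qed simp

end

section \<open>Excluding six odd vertices for \<open>t = 2\<close>\<close>

text \<open>In this bipartite graph \<open>x1\<close>, \<open>x2\<close> have the same neighbours,
  as have \<open>y1\<close>, \<open>y2\<close>, whereas \<open>x1\<close>, \<open>x3\<close> have no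
  common neighbour, nor have \<open>y1\<close>, \<open>y3\<close>. If \<open>x1\<close> is joined to
  \<open>y1\<close>, its neighbours are exactly \<open>y1\<close>, \<open>y2\<close>, an even
  number. Otherwise oddness forces the single neighbour \<open>y3\<close>, whose neighbours are then
  exactly \<open>x1\<close>, \<open>x2\<close>.\<close>

lemma two_one_patterns_not_all_odd:
  fixes \<alpha> \<beta> :: "'a \<Rightarrow> nat"
  assumes X: "X = {x1, x2, x3}" "x1 \<noteq> x2" "x1 \<noteq> x3" "x2 \<noteq> x3" "\<alpha> x1 = \<alpha> x2" "\<alpha> x3 \<noteq> \<alpha> x1"
    and Y: "Y = {y1, y2, y3}" "y1 \<noteq> y2" "y1 \<noteq> y3" "y2 \<noteq> y3" "\<beta> y1 = \<beta> y2" "\<beta> y3 \<noteq> \<beta> y1"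
    and lt: "\<And>x. x \<in> X \<Longrightarrow> \<alpha> x < h" "\<And>y. y \<in> Y \<Longrightarrow> \<beta> y < h"
    and odd: "\<And>x. x \<in> X \<Longrightarrow> odd (card {y \<in> Y. (\<alpha> x + \<beta> y + R) mod h = d})"
      "\<And>y. y \<in> Y \<Longrightarrow> odd (card {x \<in> X. (\<alpha> x + \<beta> y + R) mod h = d})"
  shows False
proof -
  have inj: "a = b" if "(a + e) mod h = (b + e) mod h" "a < h" "b < h" for a b e
  proof -
    have "int (a + e) mod int h = int (b + e) mod int h" using arg_cong[OF that(1), of int] by (simp only: of_nat_mod)
    then have "int h dvd int a - int b" by (simp add: mod_eq_dvd_iff)
    then have "int a mod int h = int b mod int h" by (simp add: mod_eq_dvd_iff)
    then show ?thesis using that(2,3) by simp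
  qed
  define E where "E x y \<longleftrightarrow> (\<alpha> x + \<beta> y + R) mod h = d" for x y
  have 1: "E x1 y \<longleftrightarrow> E x2 y" for y using X by (simp add: E_def)
  have 2: "E x y1 \<longleftrightarrow> E x y2" for x using Y by (simp add: E_def)
  have 3: "\<not> (E x1 y \<and> E x3 y)" for y
    using inj[of "\<alpha> x1" "\<beta> y + R" "\<alpha> x3"] lt(1) X by (auto simp: E_def add.assoc)
  have 4: "\<not> (E x y1 \<and> E x y3)" for x
    using inj[of "\<beta> y1" "\<alpha> x + R" "\<beta> y3"] lt(2) Y by (auto simp: E_def add.assoc add.left_commute)
  have o1: "odd (card {y \<in> Y. E x1 y})" using odd(1)[of x1] X by (simp add: E_def)
  have o2: "odd (card {x \<in> X. E x y3})" using odd(2)[of y3] Y by (simp add: E_def)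
  have "\<not> E x1 y1"
  proof
    assume "E x1 y1"
    then have "{y \<in> Y. E x1 y} = {y1, y2}" using 2 4 Y by auto
    then show False using o1 Y by simp
  qed
  then have "{y \<in> Y. E x1 y} \<subseteq> {y3}" using 2 Y by auto
  then have "{y \<in> Y. E x1 y} = {}" if "\<not> E x1 y3" using that by blast
  then have "E x1 y3" using o1 by fastforce
  then have "{x \<in> X. E x y3} = {x1, x2}" using 1 3 X by auto
  then show False using o2 X by simp
qed

text \<open>By parity and the general bound 6, only six odd vertices have to be excluded. They would
  form two label classes of three points, with adjacency given by a congruence between levels; the
  two-one patterns of the levels contradict oddness.\<close>

lemma card_odd_vertices_le_4:
  fixes u c :: "nat \<Rightarrow> nat"
  assumes q: "prime q" "q > 2" and fin: "finite S"
    and uq: "\<And>x. x \<in> S \<Longrightarrow> u x < q" and ch: "\<And>x. x \<in> S \<Longrightarrow> c x < 2 ^ h"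
  shows "card (odd_vertices (key_family 2 q h u c K) S) \<le> 4"
proof (rule ccontr)
  define F where "F = key_family 2 q h u c K"
  note edge_labels = edge_labels[where u = u and c = c and h = h and t = 2 and K = K, OF q fin uq, folded F_def]
    and edge_class_card = edge_class_card[where q = q and u = u and c = c and h = h and t = 2 and K = K, OF fin, folded F_def]
    and odd_vertices_subset = odd_vertices_subset[where u = u and c = c and h = h and t = 2 and K = K, OF q fin uq, folded F_def]
    and odd_vertices_imp_inj = odd_vertices_imp_inj[where q = q and u = u and c = c and h = h and K = K, folded F_def]
    and sum_remove_pair = sum_remove_pair[OF fin]
  assume "\<not> card (odd_vertices (key_family 2 q h u c K) S) \<le> 4"
  moreover have "card (odd_vertices F S) \<le> 6" using card_odd_vertices_le[where u = u and c = c and h = h and t = 2 and K = K, OF q fin uq, folded F_def] by simp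
  moreover have "even (card (odd_vertices F S))" using fin by (rule even_card_odd_vertices)
  moreover have "n \<le> 6 \<Longrightarrow> even n \<Longrightarrow> \<not> n \<le> 4 \<Longrightarrow> n = 6" for n :: nat by presburger
  ultimately have six: "card (odd_vertices F S) = 6" unfolding F_def by blast
  then obtain x0 where x0: "x0 \<in> odd_vertices F S" by (metis card.empty equals0I zero_neq_numeral)
  then have x0S: "x0 \<in> S" by (simp add: odd_vertices_def)
  obtain y0 where y0: "y0 \<in> co_neighbours F S x0" using co_neighbours_of_odd[OF x0] by blast
  then have y0S: "y0 \<in> S" "x0 \<noteq> y0" and y0F: "S - {x0, y0} \<in> F" by (auto simp: co_neighbours_def)
  define i j where "i = u x0" and "j = u y0"
  define X Y where "X = {z \<in> S. u z = i}" and "Y = {z \<in> S. u z = j}"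
  have fXY: "finite X" "finite Y" using fin by (auto simp: X_def Y_def)
  have sub: "odd_vertices F S \<subseteq> X \<union> Y"
    using odd_vertices_subset[of x0 y0] x0S y0 by (simp add: X_def Y_def i_def j_def)
  \<comment> \<open>A single class would have at most 2 + 2 points, too few for six odd
    vertices.\<close>
  have ij: "i \<noteq> j"
  proof
    assume "i = j"
    then have "odd_vertices F S \<subseteq> X" using sub by (simp add: X_def Y_def)
    then have "6 \<le> card X" using card_mono[OF fXY(1)] six by metis
    moreover have "card X \<le> 2 + card {z \<in> {x0, y0}. u z = i}"
      using edge_class_card[of x0 y0 i] x0S y0 by (simp add: X_def)
    moreover have "card {z \<in> {x0, y0}. u z = i} \<le> card {x0, y0}" by (intro card_mono) auto
    ultimately show False using y0S by simp
  qed
  have "{z \<in> {x0, y0}. u z = i} = {x0}" "{z \<in> {x0, y0}. u z = j} = {y0}"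
    using ij by (auto simp: i_def j_def)
  then have c3: "card X \<le> 3" "card Y \<le> 3"
    using edge_class_card[of x0 y0 i] edge_class_card[of x0 y0 j] x0S y0
    by (simp_all add: X_def Y_def)
  \<comment> \<open>There is no slack: both classes have exactly three points, and all of these are
    odd.\<close>
  have "6 \<le> card (X \<union> Y)" using card_mono[OF _ sub] fXY six by simp
  moreover have "card (X \<union> Y) \<le> card X + card Y" by (rule card_Un_le)
  ultimately have card3: "card X = 3" "card Y = 3" "card (X \<union> Y) = 6" using c3 by auto
  have eq: "odd_vertices F S = X \<union> Y"
    by (rule card_subset_eq) (use fXY sub six card3 in auto)
  have nbX: "y \<in> Y" if "x \<in> X" "y \<in> co_neighbours F S x" for x y
  proof -
    have "y \<in> S" using that by (simp add: co_neighbours_def)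
    moreover have "{i, j} = {i, u y}"
      using edge_labels[of x0 y0 x y] x0S y0 that unfolding i_def[symmetric] j_def[symmetric]
      by (simp add: X_def)
    then have "u y = j" by (simp add: doubleton_eq_iff) (use ij in blast)
    ultimately show ?thesis by (simp add: Y_def)
  qed
  have nbY: "x \<in> X" if "y \<in> Y" "x \<in> co_neighbours F S y" for x y
  proof -
    have "x \<in> S" using that by (simp add: co_neighbours_def)
    moreover have "{i, j} = {j, u x}"
      using edge_labels[of x0 y0 y x] x0S y0 that unfolding i_def[symmetric] j_def[symmetric]
      by (simp add: Y_def)
    then have "u x = i" by (simp add: doubleton_eq_iff) (use ij in blast)
    ultimately show ?thesis by (simp add: X_def)
  qed
  have injX: "inj_on c X"
    by (rule odd_vertices_imp_inj[OF _ card3(1) X_def Y_def _ ij]) (use eq nbX in auto)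
  have injY: "inj_on c Y"
    by (rule odd_vertices_imp_inj[OF _ card3(2) Y_def X_def _ ij[symmetric]]) (use eq nbY in \<open>auto simp: Un_commute\<close>)
  \<comment> \<open>\<open>R\<close> is the contribution to the third key component of the classes
    untouched by removing a point of \<open>X\<close> and a point of \<open>Y\<close>.\<close>
  define R where "R = (\<Sum>l\<in>{..<q} - {i} - {j}. split_level c {z \<in> S. u z = l})"
  define d where "d = snd (snd K)"
  have disj: "X \<inter> Y = {}" using ij by (auto simp: X_def Y_def)
  \<comment> \<open>The pair \<open>x\<close>, \<open>y\<close> has the labels of \<open>x0\<close>,
    \<open>y0\<close>, so the first two key components are already right. The remainder is well
    labelled because \<open>c\<close> is injective on both classes; only the third component
    decides.\<close>
  have edge: "S - {x, y} \<in> F \<longleftrightarrow> (split_level c (X - {x}) + split_level c (Y - {y}) + R) mod h = d"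
    if xy: "x \<in> X" "y \<in> Y" for x y
  proof -
    have xyS: "x \<in> S" "y \<in> S" "x \<noteq> y" "u x = i" "u y = j" using xy ij by (auto simp: X_def Y_def)
    have cl: "{z \<in> S - {x, y}. u z = l} =
        (if l = i then X - {x} else if l = j then Y - {y} else {z \<in> S. u z = l})" for l
      using xyS ij by (auto simp: X_def Y_def)
    have iq: "i < q" "j < q" using uq x0S y0S by (auto simp: i_def j_def)
    have "(\<Sum>l<q. split_level c {z \<in> S - {x, y}. u z = l}) =
        split_level c {z \<in> S - {x, y}. u z = i} + (split_level c {z \<in> S - {x, y}. u z = j}
          + (\<Sum>l\<in>{..<q} - {i} - {j}. split_level c {z \<in> S - {x, y}. u z = l}))"
      using iq ij by (subst sum.remove[of _ i], simp, simp, subst sum.remove[of _ j]) auto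
    also have "(\<Sum>l\<in>{..<q} - {i} - {j}. split_level c {z \<in> S - {x, y}. u z = l}) = R"
      unfolding R_def by (rule sum.cong, rule refl, subst cl) auto
    finally have T: "(\<Sum>l<q. split_level c {z \<in> S - {x, y}. u z = l}) = split_level c (X - {x}) + split_level c (Y - {y}) + R"
      unfolding cl[of i] cl[of j] using ij by simp
    have s: "sum g (S - {x, y}) = sum g (S - {x0, y0})" if "g x = g x0" "g y = g y0" for g :: "nat \<Rightarrow> nat"
      using sum_remove_pair[of x y g] sum_remove_pair[of x0 y0 g] xyS x0S y0S that by simp
    have "label_key q h u c (S - {x0, y0}) = K" using y0F by (simp add: F_def key_family_def)
    then have "label_key q h u c (S - {x, y}) = K \<longleftrightarrow> (split_level c (X - {x}) + split_level c (Y - {y}) + R) mod h = d"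
      using s[of u] s[of "\<lambda>z. (u z)\<^sup>2"] xyS unfolding label_key_def T d_def
      by (cases K) (auto simp: i_def j_def)
    moreover have "well_labelled 2 u c (S - {x, y})"
    proof -
      have g0: "well_labelled 2 u c (S - {x0, y0})" using y0F by (simp add: F_def key_family_def)
      have "card {z \<in> S - {x, y}. u z = l} \<le> 2" for l
      proof (cases "l = i \<or> l = j")
        case True
        then show ?thesis unfolding cl using card3 xy fXY by auto
      next
        case False
        then have "{z \<in> S - {x, y}. u z = l} = {z \<in> S - {x0, y0}. u z = l}"
          using xyS by (auto simp: i_def j_def)
        then show ?thesis using g0 by (simp add: well_labelled_def)
      qed
      moreover have "c z \<noteq> c w" if zw: "z \<in> S - {x, y}" "w \<in> S - {x, y}" "z \<noteq> w" "u z = u w" for z w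
      proof -
        consider "u z = i" | "u z = j" | "u z \<noteq> i" "u z \<noteq> j" by blast
        then show ?thesis
        proof cases
          case 1
          then have "z \<in> X" "w \<in> X" using zw by (simp_all add: X_def)
          then show ?thesis using inj_onD[OF injX] zw(3) by blast
        next
          case 2
          then have "z \<in> Y" "w \<in> Y" using zw by (simp_all add: Y_def)
          then show ?thesis using inj_onD[OF injY] zw(3) by blast
        next
          case 3
          then have "z \<in> S - {x0, y0}" "w \<in> S - {x0, y0}" using zw by (auto simp: i_def j_def)
          then show ?thesis using g0 zw(3,4) unfolding well_labelled_def by blast
        qed
      qed
      ultimately show ?thesis by (auto simp: well_labelled_def)
    qed
    ultimately show ?thesis by (simp add: F_def key_family_def)
  qed
  obtain x1 x2 x3 where x: "X = {x1, x2, x3}" "x1 \<noteq> x2" "x1 \<noteq> x3" "x2 \<noteq> x3"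
    "split_level c (X - {x1}) = split_level c (X - {x2})" "split_level c (X - {x3}) \<noteq> split_level c (X - {x1})"
    using split_levels_of_triple[OF card3(1) injX] by metis
  obtain y1 y2 y3 where y: "Y = {y1, y2, y3}" "y1 \<noteq> y2" "y1 \<noteq> y3" "y2 \<noteq> y3"
    "split_level c (Y - {y1}) = split_level c (Y - {y2})" "split_level c (Y - {y3}) \<noteq> split_level c (Y - {y1})"
    using split_levels_of_triple[OF card3(2) injY] by metis
  have lt: "split_level c (Z - {z}) < h" if "card Z = 3" "inj_on c Z" "Z \<subseteq> S" "z \<in> Z" for z and Z :: "nat set"
  proof -
    have "card (Z - {z}) = 2" using that by (simp add: card_Diff_singleton)
    then obtain a b where ab: "Z - {z} = {a, b}" "a \<noteq> b" by (auto simp: card_2_iff)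
    then have "a \<in> Z" "b \<in> Z" by auto
    then show ?thesis unfolding ab(1) using that ab(2) ch
      by (intro split_level_doubleton_less) (auto simp: inj_on_def)
  qed
  have XS: "X \<subseteq> S" "Y \<subseteq> S" by (auto simp: X_def Y_def)
  show False
  proof (rule two_one_patterns_not_all_odd[where \<alpha> = "\<lambda>x. split_level c (X - {x})" and \<beta> = "\<lambda>y. split_level c (Y - {y})" and R = R and d = d,
        OF x y])
    show "split_level c (X - {x}) < h" if "x \<in> X" for x using lt[OF card3(1) injX XS(1) that] .
    show "split_level c (Y - {y}) < h" if "y \<in> Y" for y using lt[OF card3(2) injY XS(2) that] .
    show "odd (card {y \<in> Y. (split_level c (X - {x}) + split_level c (Y - {y}) + R) mod h = d})" if "x \<in> X" for x
    proof -
      have "co_neighbours F S x = {y \<in> Y. (split_level c (X - {x}) + split_level c (Y - {y}) + R) mod h = d}"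
        using edge[OF that] nbX[OF that] XS disj that by (auto simp: co_neighbours_def)
      moreover have "x \<in> odd_vertices F S" using that eq by blast
      ultimately show ?thesis by (simp add: odd_vertices_def)
    qed
    show "odd (card {x \<in> X. (split_level c (X - {x}) + split_level c (Y - {y}) + R) mod h = d})" if "y \<in> Y" for y
    proof -
      have "co_neighbours F S y = {x \<in> X. (split_level c (X - {x}) + split_level c (Y - {y}) + R) mod h = d}"
        using edge[OF _ that] nbY[OF that] XS disj that by (auto simp: co_neighbours_def insert_commute)
      moreover have "y \<in> odd_vertices F S" using that eq by blast
      ultimately show ?thesis by (simp add: odd_vertices_def)
    qed
  qed
qed

subsection \<open>Counting labellings\<close>

text \<open>A map constant on \<open>T\<close> is determined by its restriction to
  \<open>V'\<close>, which keeps one point of \<open>T\<close> and drops the other \<open>t\<close>.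
  In probabilistic terms, constancy on \<open>T\<close> has probability at most q^(-t).\<close>

lemma card_constant_on:
  assumes "finite V" "T \<subseteq> V" "card T = Suc t"
  shows "card {u \<in> V \<rightarrow>\<^sub>E {..<q::nat}. \<forall>x\<in>T. \<forall>y\<in>T. u x = u y} * q ^ t \<le> q ^ card V"
proof -
  obtain x0 where x0: "x0 \<in> T" using assms(3) by fastforce
  define V' where "V' = insert x0 (V - T)"
  have fT: "finite T" using assms finite_subset by blast
  have cV: "card T \<le> card V" by (rule card_mono[OF assms(1,2)])
  have cV': "card V' = card V - t"
    using assms x0 fT cV by (simp add: V'_def card_Diff_subset)
  have "card {u \<in> V \<rightarrow>\<^sub>E {..<q}. \<forall>x\<in>T. \<forall>y\<in>T. u x = u y} \<le> card (V' \<rightarrow>\<^sub>E {..<q})"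
  proof (rule card_inj_on_le)
    show "inj_on (\<lambda>u. restrict u V') {u \<in> V \<rightarrow>\<^sub>E {..<q}. \<forall>x\<in>T. \<forall>y\<in>T. u x = u y}"
    proof (rule inj_onI, clarify, rule ext)
      fix u v :: "_ \<Rightarrow> nat" and x
      assume u: "u \<in> V \<rightarrow>\<^sub>E {..<q}" "\<forall>x\<in>T. \<forall>y\<in>T. u x = u y"
        and v: "v \<in> V \<rightarrow>\<^sub>E {..<q}" "\<forall>x\<in>T. \<forall>y\<in>T. v x = v y"
        and eq: "restrict u V' = restrict v V'"
      have eq': "u y = v y" if "y \<in> V'" for y using fun_cong[OF eq, of y] that by simp
      show "u x = v x"
      proof (cases "x \<in> V")
        case True
        then show ?thesis
        proof (cases "x \<in> T")
          case True
          then show ?thesis using u(2) v(2) x0 eq'[of x0] by (metis V'_def insertI1)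
        next
          case False
          then show ?thesis using \<open>x \<in> V\<close> eq' by (simp add: V'_def)
        qed
      next
        case False
        then show ?thesis using u(1) v(1) by (metis PiE_arb)
      qed
    qed
    show "(\<lambda>u. restrict u V') ` {u \<in> V \<rightarrow>\<^sub>E {..<q}. \<forall>x\<in>T. \<forall>y\<in>T. u x = u y} \<subseteq> V' \<rightarrow>\<^sub>E {..<q}"
    proof (intro image_subsetI)
      fix u assume "u \<in> {u \<in> V \<rightarrow>\<^sub>E {..<q}. \<forall>x\<in>T. \<forall>y\<in>T. u x = u y}"
      moreover have "V' \<subseteq> V" using assms x0 by (auto simp: V'_def)
      ultimately have "\<forall>y\<in>V'. u y \<in> {..<q}" by blast
      then show "restrict u V' \<in> V' \<rightarrow>\<^sub>E {..<q}" unfolding restrict_PiE_iff .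
    qed
    show "finite (V' \<rightarrow>\<^sub>E {..<q})" using assms by (intro finite_PiE) (auto simp: V'_def)
  qed
  also have "\<dots> = q ^ (card V - t)" using assms cV' by (simp add: card_funcsetE V'_def)
  finally have "card {u \<in> V \<rightarrow>\<^sub>E {..<q}. \<forall>x\<in>T. \<forall>y\<in>T. u x = u y} * q ^ t \<le> q ^ (card V - t) * q ^ t"
    by (rule mult_right_mono) simp
  also have "\<dots> = q ^ card V" using cV assms by (simp flip: power_add)
  finally show ?thesis .
qed

section \<open>Random labellings and isolated points\<close>

text \<open>The sample space, with probabilities expressed as cardinalities. Extensional functions
  keep it finite.\<close>

definition labellings :: "nat \<Rightarrow> nat \<Rightarrow> nat set \<Rightarrow> ((nat \<Rightarrow> nat) \<times> (nat \<Rightarrow> nat)) set" where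
  "labellings q h V = (V \<rightarrow>\<^sub>E {..<q}) \<times> (V \<rightarrow>\<^sub>E {..<2 ^ h})"

text \<open>The favourable event for a set \<open>e\<close> and a point \<open>x\<close> in it: it
  makes \<open>e\<close> an edge of the coboundary belonging to the key of
  \<open>e - {x}\<close>.\<close>

definition isolating :: "nat \<Rightarrow> nat \<Rightarrow> nat \<Rightarrow> nat set \<Rightarrow> nat set \<Rightarrow> nat \<Rightarrow> ((nat \<Rightarrow> nat) \<times> (nat \<Rightarrow> nat)) set" where
  "isolating t q h V e x =
     {(u, c) \<in> labellings q h V. well_labelled t u c (e - {x}) \<and> (\<forall>y\<in>e - {x}. u y \<noteq> u x)}"

lemma finite_labellings: "finite V \<Longrightarrow> finite (labellings q h V)"
  by (simp add: labellings_def finite_PiE)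

lemma card_labellings: "finite V \<Longrightarrow> card (labellings q h V) = q ^ card V * (2 ^ h) ^ card V"
  by (simp add: labellings_def card_cartesian_product card_funcsetE)

lemma card_UN_le_bound:
  assumes "finite I" "\<And>i. i \<in> I \<Longrightarrow> real (card (A i)) \<le> b" "real (card I) * b \<le> s"
  shows "real (card (\<Union>i\<in>I. A i)) \<le> s"
proof -
  have "card (\<Union>i\<in>I. A i) \<le> (\<Sum>i\<in>I. card (A i))" by (rule card_UN_le[OF assms(1)])
  then have "real (card (\<Union>i\<in>I. A i)) \<le> (\<Sum>i\<in>I. real (card (A i)))"
    by (metis of_nat_le_iff of_nat_sum)
  also have "\<dots> \<le> real (card I) * b" using assms(2) by (rule sum_bounded_above)
  finally show ?thesis using assms(3) by simp
qed

text \<open>Union bound over three failures: t + 1 points of \<open>e\<close> share \<open>u\<close>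
  (\<open>B1\<close>), another point has the label of \<open>x\<close> (\<open>B2\<close>), or two
  points agree in both \<open>u\<close> and \<open>c\<close> (\<open>B3\<close>). The three
  numerical hypotheses limit each to an eighth of all labellings.\<close>

lemma card_isolating:
  assumes V: "finite V" and e: "e \<subseteq> V" "card e = r" "x \<in> e"
    and q: "8 * r \<le> q" "8 * r ^ (t + 1) \<le> q ^ t" and h: "r \<le> 2 ^ h"
  shows "card (labellings q h V) \<le> 2 * card (isolating t q h V e x)"
proof -
  define U where "U T = {u \<in> V \<rightarrow>\<^sub>E {..<q}. \<forall>x\<in>T. \<forall>y\<in>T. u x = u y}" for T
  define C where "C T = {c \<in> V \<rightarrow>\<^sub>E {..<(2::nat) ^ h}. \<forall>x\<in>T. \<forall>y\<in>T. c x = c y}" for T :: "nat set"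
  define N where "N = real (card (labellings q h V))"
  have fe: "finite e" using V e finite_subset by blast
  have r: "r > 0" using e fe card_gt_0_iff by blast
  have N: "N = real q ^ card V * real (2 ^ h) ^ card V"
    using V by (simp add: N_def card_labellings)
  have U: "real (card (U T)) * real q ^ s \<le> real q ^ card V" if "T \<subseteq> e" "card T = Suc s" for T s
  proof -
    have "card (U T) * q ^ s \<le> q ^ card V"
      unfolding U_def using that V e by (intro card_constant_on) auto
    then have "real (card (U T) * q ^ s) \<le> real (q ^ card V)" by (simp only: of_nat_le_iff)
    then show ?thesis by (simp only: of_nat_mult of_nat_power)
  qed
  have C: "real (card (C T)) * real (2 ^ h) ^ s \<le> real (2 ^ h) ^ card V" if "T \<subseteq> e" "card T = Suc s" for T s
  proof -
    have "card (C T) * (2 ^ h) ^ s \<le> (2 ^ h) ^ card V"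
      unfolding C_def using that V e by (intro card_constant_on) auto
    then have "real (card (C T) * (2 ^ h) ^ s) \<le> real ((2 ^ h) ^ card V)" by (simp only: of_nat_le_iff)
    then show ?thesis by (simp only: of_nat_mult of_nat_power)
  qed
  \<comment> \<open>The empty set imposes no condition, so \<open>C {}\<close> consists of all
    second labellings.\<close>
  have cC: "card (C {}) = (2 ^ h) ^ card V" using V by (simp add: C_def card_funcsetE)
  have UC: "real (card (U T \<times> C {})) * real q ^ s \<le> N" if "T \<subseteq> e" "card T = Suc s" for T s
  proof -
    have "real (card (U T)) * real q ^ s * real (2 ^ h) ^ card V \<le> real q ^ card V * real (2 ^ h) ^ card V"
      by (rule mult_right_mono[OF U[OF that]]) simp
    then show ?thesis unfolding N card_cartesian_product cC by (simp add: mult_ac)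
  qed

  define I1 where "I1 = {T. T \<subseteq> e \<and> card T = t + 1}"
  define I2 where "I2 = e - {x}"
  define I3 where "I3 = {(y, z). y \<in> e \<and> z \<in> e \<and> y \<noteq> z}"
  define B1 where "B1 = (\<Union>T\<in>I1. U T \<times> C {})"
  define B2 where "B2 = (\<Union>y\<in>I2. U {x, y} \<times> C {})"
  define B3 where "B3 = (\<Union>(y, z)\<in>I3. U {y, z} \<times> C {y, z})"
  have b1: "real (card B1) \<le> N / 8"
    unfolding B1_def
  proof (rule card_UN_le_bound[where b = "N / (8 * real r ^ (t + 1))"])
    show "finite I1" using fe by (simp add: I1_def)
    show "real (card (U T \<times> C {})) \<le> N / (8 * real r ^ (t + 1))" if "T \<in> I1" for T
    proof -
      have "8 * real r ^ (t + 1) \<le> real q ^ t"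
        using of_nat_mono[OF q(2), where 'a = real] by simp
      then have "real (card (U T \<times> C {})) * (8 * real r ^ (t + 1)) \<le> real (card (U T \<times> C {})) * real q ^ t"
        by (rule mult_left_mono) simp
      also have "\<dots> \<le> N" using UC[of T t] that by (simp add: I1_def)
      finally show ?thesis using r by (simp add: pos_le_divide_eq)
    qed
    have "card I1 = r choose (t + 1)" unfolding I1_def n_subsets[OF fe] e(2) ..
    also have "\<dots> \<le> r ^ (t + 1)"
      using binomial_le_pow[of "t + 1" r] binomial_eq_0[of r "t + 1"] by linarith
    finally have "card I1 \<le> r ^ (t + 1)" .
    then have "real (card I1) \<le> real r ^ (t + 1)" by (simp only: of_nat_power[symmetric] of_nat_le_iff)
    then have "real (card I1) * (N / (8 * real r ^ (t + 1))) \<le> real r ^ (t + 1) * (N / (8 * real r ^ (t + 1)))"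
      by (rule mult_right_mono) (simp add: N)
    also have "\<dots> = N / 8" using r by simp
    finally show "real (card I1) * (N / (8 * real r ^ (t + 1))) \<le> N / 8" .
  qed
  have b2: "real (card B2) \<le> N / 8"
    unfolding B2_def
  proof (rule card_UN_le_bound[where b = "N / (8 * real r)"])
    show "finite I2" using fe by (simp add: I2_def)
    show "real (card (U {x, y} \<times> C {})) \<le> N / (8 * real r)" if "y \<in> I2" for y
    proof -
      have "8 * real r \<le> real q" using q(1) by linarith
      then have "real (card (U {x, y} \<times> C {})) * (8 * real r) \<le> real (card (U {x, y} \<times> C {})) * real q"
        by (rule mult_left_mono) simp
      also have "\<dots> \<le> N" using UC[of "{x, y}" 1] that e by (auto simp: I2_def)
      finally show ?thesis using r by (simp add: pos_le_divide_eq)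
    qed
    have "card I2 \<le> r" using fe e by (simp add: I2_def)
    then have "real (card I2) * (N / (8 * real r)) \<le> real r * (N / (8 * real r))"
      by (intro mult_right_mono) (auto simp: N)
    also have "\<dots> = N / 8" using r by simp
    finally show "real (card I2) * (N / (8 * real r)) \<le> N / 8" .
  qed
  have b3: "real (card B3) \<le> N / 8"
    unfolding B3_def
  proof (rule card_UN_le_bound[where b = "N / (8 * real r * real r)"])
    have I3: "I3 \<subseteq> e \<times> e" by (auto simp: I3_def)
    then show "finite I3" using fe finite_subset by blast
    show "real (card (case yz of (y, z) \<Rightarrow> U {y, z} \<times> C {y, z})) \<le> N / (8 * real r * real r)" if yzI: "yz \<in> I3" for yz
    proof -
      obtain y z where yz: "yz = (y, z)" "y \<in> e" "z \<in> e" "y \<noteq> z" using yzI by (auto simp: I3_def)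
      \<comment> \<open>The two labellings are independent, so a pair agrees in both with
        probability at most 1 / (q 2^h), which is at most 1 / (8 r^2).\<close>
      have "8 * real r \<le> real q" using q(1) by linarith
      moreover have "real r \<le> real (2 ^ h)" using h by (simp only: of_nat_le_iff)
      ultimately have "8 * real r * real r \<le> real q * real (2 ^ h)" by (intro mult_mono) auto
      then have "real (card (U {y, z} \<times> C {y, z})) * (8 * real r * real r)
          \<le> real (card (U {y, z} \<times> C {y, z})) * (real q * real (2 ^ h))"
        by (rule mult_left_mono) simp
      also have "\<dots> = (real (card (U {y, z})) * real q) * (real (card (C {y, z})) * real (2 ^ h))"
        by (simp add: card_cartesian_product mult_ac)
      also have "\<dots> \<le> real q ^ card V * real (2 ^ h) ^ card V"
        using U[of "{y, z}" 1] C[of "{y, z}" 1] yz by (intro mult_mono) auto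
      finally show ?thesis using r yz(1) by (simp add: pos_le_divide_eq N)
    qed
    have "card I3 \<le> r * r"
      using card_mono[OF _ I3] fe e by (simp add: card_cartesian_product)
    then have "real (card I3) \<le> real r * real r" by (simp only: of_nat_mult[symmetric] of_nat_le_iff)
    then have "real (card I3) * (N / (8 * real r * real r)) \<le> (real r * real r) * (N / (8 * real r * real r))"
      by (rule mult_right_mono) (simp add: N)
    also have "\<dots> = N / 8" using r by simp
    finally show "real (card I3) * (N / (8 * real r * real r)) \<le> N / 8" .
  qed
  have "labellings q h V \<subseteq> isolating t q h V e x \<union> (B1 \<union> B2 \<union> B3)"
  proof
    fix w assume w: "w \<in> labellings q h V"
    obtain u c where uc: "w = (u, c)" by force
    then have m: "u \<in> V \<rightarrow>\<^sub>E {..<q}" "c \<in> V \<rightarrow>\<^sub>E {..<2 ^ h}" using w by (auto simp: labellings_def)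
    have cC: "c \<in> C {}" using m by (simp add: C_def)
    show "w \<in> isolating t q h V e x \<union> (B1 \<union> B2 \<union> B3)"
    proof (rule ccontr)
      assume n: "w \<notin> isolating t q h V e x \<union> (B1 \<union> B2 \<union> B3)"
      have "\<forall>y\<in>e - {x}. u y \<noteq> u x"
      proof (rule ballI, rule notI)
        fix y assume y: "y \<in> e - {x}" "u y = u x"
        then have "w \<in> U {x, y} \<times> C {}" using m cC unfolding uc U_def by simp
        then have "w \<in> B2" using y(1) unfolding B2_def I2_def by blast
        then show False using n by blast
      qed
      moreover have "c y \<noteq> c z" if "y \<in> e - {x}" "z \<in> e - {x}" "y \<noteq> z" "u y = u z" for y z
      proof
        assume "c y = c z"
        then have "w \<in> U {y, z} \<times> C {y, z}" using that m unfolding uc U_def C_def by auto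
        moreover have "(y, z) \<in> I3" using that by (simp add: I3_def)
        ultimately have "w \<in> B3" unfolding B3_def by blast
        then show False using n by blast
      qed
      moreover have "card {y \<in> e - {x}. u y = i} \<le> t" for i
      proof (rule ccontr)
        assume "\<not> card {y \<in> e - {x}. u y = i} \<le> t"
        then have "t + 1 \<le> card {y \<in> e - {x}. u y = i}" by simp
        then obtain T where T: "T \<subseteq> {y \<in> e - {x}. u y = i}" "card T = t + 1"
          by (rule obtain_subset_with_card_n)
        then have "\<forall>y\<in>T. u y = i" by blast
        then have "w \<in> U T \<times> C {}" using m cC unfolding uc U_def by simp
        moreover have "T \<in> I1" using T by (auto simp: I1_def)
        ultimately have "w \<in> B1" unfolding B1_def by blast
        then show False using n by blast
      qed
      ultimately have "w \<in> isolating t q h V e x"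
        using w unfolding isolating_def well_labelled_def uc by blast
      then show False using n by blast
    qed
  qed
  moreover have "finite (isolating t q h V e x)"
    by (rule finite_subset[OF _ finite_labellings[OF V]]) (auto simp: isolating_def)
  moreover have sub: "B1 \<subseteq> labellings q h V" "B2 \<subseteq> labellings q h V" "B3 \<subseteq> labellings q h V"
    by (auto simp: B1_def B2_def B3_def labellings_def U_def C_def)
  moreover have "finite (B1 \<union> B2 \<union> B3)"
    using sub finite_labellings[OF V] by (meson Un_least finite_subset)
  ultimately have "card (labellings q h V) \<le> card (isolating t q h V e x \<union> (B1 \<union> B2 \<union> B3))"
    by (intro card_mono) auto
  also have "\<dots> \<le> card (isolating t q h V e x) + card (B1 \<union> B2 \<union> B3)" by (rule card_Un_le)
  also have "card (B1 \<union> B2 \<union> B3) \<le> card B1 + card B2 + card B3"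
    by (meson add_le_mono1 card_Un_le le_trans)
  finally have "N \<le> real (card (isolating t q h V e x)) + (real (card B1) + real (card B2) + real (card B3))"
    unfolding N_def by (simp only: of_nat_add[symmetric] of_nat_le_iff)
  moreover have "N \<ge> 0" by (simp add: N)
  ultimately have "N \<le> 2 * real (card (isolating t q h V e x))" using b1 b2 b3 by linarith
  then show ?thesis unfolding N_def by linarith
qed

section \<open>From labellings to a lower bound on the density\<close>

text \<open>Edges inside an (r+1)-set are counted by odd vertices, whose number is even. It is at
  most 2t + 2 in general and at most 4 for \<open>t = 2\<close>, which covers both alternatives for
  \<open>t\<close> and \<open>k\<close>.\<close>

lemma even_le_coboundary:
  assumes V: "finite V" and uc: "(u, c) \<in> labellings q h V" and q: "prime q" "q > 2"
    and t: "t + 1 \<le> k \<or> t = 2 \<and> k = 2"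
  shows "even_le k r V (coboundary r V (key_family t q h u c K))"
  unfolding even_le_def
proof (intro allI impI)
  fix S assume S: "S \<subseteq> V \<and> card S = r + 1"
  then have fS: "finite S" using V finite_subset by blast
  have u: "u x < q" if "x \<in> S" for x using uc S that by (auto simp: labellings_def)
  have c: "c x < 2 ^ h" if "x \<in> S" for x using uc S that by (auto simp: labellings_def)
  have "card {e \<in> coboundary r V (key_family t q h u c K). e \<subseteq> S} = card (odd_vertices (key_family t q h u c K) S)"
    using fS S by (intro card_coboundary) auto
  moreover have "even (card (odd_vertices (key_family t q h u c K) S))" by (rule even_card_odd_vertices[OF fS])
  moreover have "card (odd_vertices (key_family t q h u c K) S) \<le> 2 * k"
    using t
  proof
    assume "t + 1 \<le> k"
    moreover have "card (odd_vertices (key_family t q h u c K) S) \<le> 2 * t + 2"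
      by (rule card_odd_vertices_le[OF q fS]) (fact u)
    ultimately show ?thesis by linarith
  next
    assume t: "t = 2 \<and> k = 2"
    have "card (odd_vertices (key_family 2 q h u c K) S) \<le> 4"
      by (rule card_odd_vertices_le_4[OF q fS]) (fact u c)+
    then show ?thesis using t by simp
  qed
  ultimately show "card {e \<in> coboundary r V (key_family t q h u c K). e \<subseteq> S} \<in> {2 * i |i. i \<le> k}"
    by (auto elim!: evenE)
qed

text \<open>
  If the label of \<open>x\<close> occurs only once in \<open>e\<close>, then \<open>e - {x}\<close> is the only member of its family inside \<open>e\<close>,
  since the key determines the label of the removed point.
\<close>

lemma isolating_imp:
  assumes V: "finite V" and e: "e \<subseteq> V" "card e = r" "x \<in> e" and uc: "(u, c) \<in> isolating t q h V e x"
  shows isolating_unique: "\<And>y. y \<in> e \<Longrightarrow> label_key q h u c (e - {y}) = label_key q h u c (e - {x}) \<Longrightarrow> y = x"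
    and isolating_coboundary: "e \<in> coboundary r V (key_family t q h u c (label_key q h u c (e - {x})))"
proof -
  have fe: "finite e" using V e finite_subset by blast
  have u: "u y < q" if "y \<in> e" for y using uc that e by (auto simp: isolating_def labellings_def)
  have g: "well_labelled t u c (e - {x})" "\<And>y. y \<in> e - {x} \<Longrightarrow> u y \<noteq> u x"
    using uc by (auto simp: isolating_def)
  show un: "y = x" if y: "y \<in> e" "label_key q h u c (e - {y}) = label_key q h u c (e - {x})" for y
  proof (rule ccontr)
    assume "y \<noteq> x"
    have "sum u e = u y + sum u (e - {y})" "sum u e = u x + sum u (e - {x})"
      using sum.remove[OF fe] y e by auto
    then have "int (u x) - int (u y) = int (sum u (e - {y})) - int (sum u (e - {x}))" by linarith
    moreover have "sum u (e - {y}) mod q = sum u (e - {x}) mod q"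
      using y(2) by (simp only: label_key_def prod.inject)
    then have "int (sum u (e - {y})) mod int q = int (sum u (e - {x})) mod int q"
      using arg_cong[of _ _ int] by (simp only: of_nat_mod[symmetric])
    ultimately have "int q dvd int (u x) - int (u y)" by (simp only: mod_eq_dvd_iff)
    then have "int (u x) mod int q = int (u y) mod int q" by (simp add: mod_eq_dvd_iff)
    then have "u x = u y" using u y e by simp
    then show False using g(2)[of y] y \<open>y \<noteq> x\<close> by auto
  qed
  have "{y \<in> e. e - {y} \<in> key_family t q h u c (label_key q h u c (e - {x}))} = {x}"
    using un e g(1) by (auto simp: key_family_def)
  then show "e \<in> coboundary r V (key_family t q h u c (label_key q h u c (e - {x})))"
    using e by (simp add: coboundary_def)
qed

text \<open>Double counting of the quadruples (e, x, u, c) in \<open>A\<close>. At least half of the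
  labellings are favourable for each pair (e, x); on the other hand each labelling and each of the
  q^2 h keys yields an admissible hypergraph, with at most \<open>M_le k n r\<close> edges.\<close>

lemma density_bound:
  assumes q: "prime q" "q > 2" "8 * r \<le> q" "8 * r ^ (t + 1) \<le> q ^ t"
    and h: "r \<le> 2 ^ h" "h > 0" and t: "t + 1 \<le> k \<or> t = 2 \<and> k = 2"
  shows "(n choose r) * r \<le> 2 * (q * q * h) * M_le k n r"
proof -
  define V where "V = {..<n}"
  define L where "L = labellings q h V"
  define KK where "KK = {..<q} \<times> {..<q} \<times> {..<h}"
  define R where "R = {e. e \<subseteq> V \<and> card e = r}"
  define A where "A = (SIGMA e:R. SIGMA x:e. isolating t q h V e x)"
  define B where "B = (SIGMA w:L \<times> KK. coboundary r V (key_family t q h (fst (fst w)) (snd (fst w)) (snd w)))"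
  define g where "g z = (case z of (e, x, u, c) \<Rightarrow> (((u, c), label_key q h u c (e - {x})), e))"
    for z :: "nat set \<times> nat \<times> (nat \<Rightarrow> nat) \<times> (nat \<Rightarrow> nat)"
  have fV: "finite V" "card V = n" by (auto simp: V_def)
  have fL: "finite L" unfolding L_def by (rule finite_labellings[OF fV(1)])
  have fKK: "finite KK" "card KK = q * q * h" by (auto simp: KK_def card_cartesian_product)
  have fR: "finite R" unfolding R_def by (rule finite_subset[of _ "Pow V"]) (use fV in auto)
  have fcob: "finite (coboundary r V H)" for H
    by (rule finite_subset[of _ "Pow V"]) (use fV in \<open>auto simp: coboundary_def\<close>)
  have fe: "finite e" if "e \<in> R" for e using that fV finite_subset by (auto simp: R_def)
  have iso: "isolating t q h V e x \<subseteq> L" for e x by (auto simp: isolating_def L_def)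
  then have fiso: "finite (isolating t q h V e x)" for e x using fL finite_subset by blast
  have L0: "card L > 0"
    using q by (simp add: L_def card_labellings[OF fV(1)] prime_gt_0_nat)
  have "card A \<le> card B"
  proof (rule card_inj_on_le)
    \<comment> \<open>The point \<open>x\<close> is not stored in the image, but \<open>e\<close>,
      the labelling and the key determine it.\<close>
    show "inj_on g A"
    proof (rule inj_onI)
      fix z z' assume z: "z \<in> A" "z' \<in> A" "g z = g z'"
      obtain e x u c where z1: "z = (e, x, u, c)" by (metis prod_cases4)
      obtain e' x' u' c' where z2: "z' = (e', x', u', c')" by (metis prod_cases4)
      have eq: "e' = e" "u' = u" "c' = c" "label_key q h u c (e - {x'}) = label_key q h u c (e - {x})"
        using z(3) unfolding z1 z2 g_def by auto
      have m: "e \<subseteq> V" "card e = r" "x \<in> e" "(u, c) \<in> isolating t q h V e x" "x' \<in> e"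
        using z unfolding z1 z2 A_def eq R_def by auto
      show "z = z'" using isolating_unique[OF fV(1) m eq(4)] eq z1 z2 by simp
    qed
    show "g ` A \<subseteq> B"
    proof (rule image_subsetI)
      fix z assume z: "z \<in> A"
      obtain e x u c where z1: "z = (e, x, u, c)" by (metis prod_cases4)
      have m: "e \<subseteq> V" "card e = r" "x \<in> e" "(u, c) \<in> isolating t q h V e x"
        using z unfolding z1 A_def R_def by auto
      have "label_key q h u c (e - {x}) \<in> KK"
        using q h by (auto simp: label_key_def KK_def prime_gt_0_nat)
      then show "g z \<in> B"
        using isolating_coboundary[OF fV(1) m] m(4) iso unfolding z1 g_def B_def by auto
    qed
    show "finite B" unfolding B_def using fL fKK fcob by (intro finite_SigmaI) auto
  qed
  also have "card B = (\<Sum>w\<in>L \<times> KK. card (coboundary r V (key_family t q h (fst (fst w)) (snd (fst w)) (snd w))))"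
    unfolding B_def using fL fKK fcob by (intro card_SigmaI) auto
  also have "\<dots> \<le> (\<Sum>w\<in>L \<times> KK. M_le k n r)"
  proof (rule sum_mono)
    fix w assume "w \<in> L \<times> KK"
    then have "(fst (fst w), snd (fst w)) \<in> labellings q h V" by (auto simp: L_def)
    from even_le_coboundary[OF fV(1) this q(1,2) t]
    show "card (coboundary r V (key_family t q h (fst (fst w)) (snd (fst w)) (snd w))) \<le> M_le k n r"
      unfolding fV(2)[symmetric] using fV by (intro M_le_upper) (auto simp: r_graph_def coboundary_def)
  qed
  also have "\<dots> = card L * (q * q * h) * M_le k n r"
    using fKK by (simp add: card_cartesian_product)
  finally have AB: "card A \<le> card L * (q * q * h) * M_le k n r" .
  \<comment> \<open>The gain of a factor \<open>r\<close> comes from the choice of the removed point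
    \<open>x\<close> in \<open>e\<close>.\<close>
  have "card L * ((n choose r) * r) = (\<Sum>e\<in>R. \<Sum>x\<in>e. card L)"
    using n_subsets[OF fV(1), of r] fV by (simp add: R_def)
  also have "\<dots> \<le> (\<Sum>e\<in>R. \<Sum>x\<in>e. 2 * card (isolating t q h V e x))"
    unfolding L_def by (intro sum_mono card_isolating[OF fV(1)]) (use q h in \<open>auto simp: R_def\<close>)
  also have "\<dots> = 2 * (\<Sum>e\<in>R. \<Sum>x\<in>e. card (isolating t q h V e x))"
    by (simp add: sum_distrib_left)
  also have "(\<Sum>e\<in>R. \<Sum>x\<in>e. card (isolating t q h V e x)) = card A"
  proof -
    have "card A = (\<Sum>e\<in>R. card (SIGMA x:e. isolating t q h V e x))"
      unfolding A_def using fR fe fiso by (intro card_SigmaI) auto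
    also have "\<dots> = (\<Sum>e\<in>R. \<Sum>x\<in>e. card (isolating t q h V e x))"
      using fe fiso by (intro sum.cong refl card_SigmaI) auto
    finally show ?thesis ..
  qed
  also have "2 * card A \<le> 2 * (card L * (q * q * h) * M_le k n r)" using AB by simp
  also have "\<dots> = card L * (2 * (q * q * h) * M_le k n r)" by (simp only: mult_ac)
  finally have "card L * ((n choose r) * r) \<le> card L * (2 * (q * q * h) * M_le k n r)" .
  then show ?thesis using L0 by simp
qed

text \<open>The finite bound has a constant independent of \<open>n\<close>, so it passes to the
  limit.\<close>

lemma m_le_ge:
  assumes "prime q" "q > 2" "8 * r \<le> q" "8 * r ^ (t + 1) \<le> q ^ t"
    and "r \<le> 2 ^ h" "h > 0" "t + 1 \<le> k \<or> t = 2 \<and> k = 2"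
  shows "real r / (2 * (real q)\<^sup>2 * real h) \<le> m_le k r"
proof (rule LIMSEQ_le_const[OF M_le_density_LIMSEQ])
  have pos: "2 * (real q)\<^sup>2 * real h > 0" using assms by auto
  show "\<exists>N. \<forall>n\<ge>N. real r / (2 * (real q)\<^sup>2 * real h) \<le> real (M_le k n r) / real (n choose r)"
  proof (intro exI allI impI)
    fix n assume "r \<le> n"
    then have b: "real (n choose r) > 0" by simp
    have "real ((n choose r) * r) \<le> real (2 * (q * q * h) * M_le k n r)"
      unfolding of_nat_le_iff by (rule density_bound[OF assms])
    then have "real (n choose r) * real r \<le> 2 * (real q)\<^sup>2 * real h * real (M_le k n r)"
      by (simp add: power2_eq_square mult_ac)
    then show "real r / (2 * (real q)\<^sup>2 * real h) \<le> real (M_le k n r) / real (n choose r)"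
      using pos b by (simp add: divide_le_eq pos_le_divide_eq mult_ac)
  qed
qed

subsection \<open>The choice of parameters\<close>

text \<open>This is the hypothesis of \<open>prime_between\<close> after taking logarithms, for
  \<open>A\<close> about 8 r^a and \<open>B\<close> about r^b / ln r. The terms + 1 and - 3 absorb
  the rounding of \<open>A\<close> and \<open>B\<close> and the 2 in the exponent B - 2.\<close>

lemma window_asymptotics:
  fixes a b :: real
  assumes "1 < a" "a < b"
  shows "\<forall>\<^sub>F r in sequentially.
    (8 * real r powr a + 1) * (b * ln (real r)) < (real r powr b / ln (real r) - 3) * ln 2"
  using assms by real_asymp

text \<open>The ends of the window differ by a power of \<open>r\<close> up to a logarithm, so the
  crude prime count suffices. The logarithm in the upper end later supplies the one in the
  density.\<close>

lemma prime_in_window: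
  fixes a b :: real
  assumes "1 < a" "a < b" "b \<le> 2"
  shows "\<forall>\<^sub>F r in sequentially. \<exists>q. prime q \<and> 8 * real r powr a < real q \<and> real q \<le> real r powr b / ln (real r)"
proof -
  have "\<forall>\<^sub>F r in sequentially. real r powr b / ln (real r) \<ge> 4" using assms by real_asymp
  moreover have "\<forall>\<^sub>F r in sequentially. r \<ge> (3::nat)" by (rule eventually_ge_at_top)
  ultimately show ?thesis using window_asymptotics[OF assms(1,2)]
  proof eventually_elim
    case (elim r)
    define A where "A = nat \<lceil>8 * real r powr a\<rceil>"
    define B where "B = nat \<lfloor>real r powr b / ln (real r)\<rfloor>"
    have r: "real r \<ge> 3" using elim(2) by simp
    have ln: "ln (real r) \<ge> 1"
      using ln_mono[of "exp 1" "real r"] exp_le r by simp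
    have A: "8 * real r powr a \<le> real A" "real A \<le> 8 * real r powr a + 1"
      unfolding A_def by (auto simp: of_nat_ceiling)
    have B: "real B \<le> real r powr b / ln (real r)" "real r powr b / ln (real r) - 1 \<le> real B"
      unfolding B_def using elim(1) by linarith+
    have B3: "B \<ge> 3" using elim(1) B(2) by linarith
    have "real r powr b / ln (real r) \<le> real r powr b" 
      using divide_left_mono[of 1 "ln (real r)" "real r powr b"] ln by simp
    then have "real B \<le> real r powr b" using B(1) by linarith
    then have "ln (real B) \<le> b * ln (real r)"
      using ln_mono[of "real B" "real r powr b"] B3 r by (simp add: ln_powr)
    then have "real A * ln (real B) \<le> (8 * real r powr a + 1) * (b * ln (real r))"
      using A B3 by (intro mult_mono) auto
    also have "\<dots> < (real r powr b / ln (real r) - 3) * ln 2" by (rule elim(3))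
    also have "\<dots> \<le> real (B - 2) * ln 2"
      using B(2) B3 by (intro mult_right_mono) auto
    finally have "ln (real B ^ A) < ln (2 ^ (B - 2))" using B3 by (simp add: ln_realpow)
    then have "real B ^ A < 2 ^ (B - 2)" using B3 by (subst (asm) ln_less_cancel_iff) auto
    then have "real (B ^ A) < real (2 ^ (B - 2))" by simp
    then have "B ^ A < 2 ^ (B - 2)" by (simp only: of_nat_less_iff)
    then obtain q where q: "prime q" "A < q" "q \<le> B" using prime_between B3 by blast
    have "8 * real r powr a < real q" using A(1) q(2) by linarith
    moreover have "real q \<le> real r powr b / ln (real r)" using B(1) q(3) by linarith
    ultimately show ?case using q(1) by blast
  qed
qed

theorem theorem4:
  fixes k :: nat
  assumes "k \<ge> 2"
  shows "\<exists>c::real. c > 0 \<and> (\<exists>r0::nat. \<forall>r\<ge>r0.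
           m_le k r \<ge> c * real r powr (- 1 - 4 / real k) * ln (real r) powr (1 / real k))"
proof -
  \<comment> \<open>This is k - 1 for \<open>k\<close> at least 3, and 2 for \<open>k = 2\<close>,
    where the sharper bound on odd vertices is available.\<close>
  define t where "t = max 2 (k - 1)"
  \<comment> \<open>The exponent \<open>a\<close> is what 8 r^(t+1) \<le> q^t requires of
    \<open>q\<close>, and \<open>b\<close> is the largest exponent allowed by the target density.
    There is room between them because k < 2t.\<close>
  define a b where "a = 1 + 1 / real t" and "b = 1 + 2 / real k"
  have t: "t + 1 \<le> k \<or> t = 2 \<and> k = 2" "t \<ge> 2" using assms by (auto simp: t_def)
  have "real k < 2 * real t" using assms by (auto simp: t_def max_def)
  then have ab: "1 < a" "a < b" "b \<le> 2"
    using assms t(2) by (auto simp: a_def b_def field_simps)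
  have "\<forall>\<^sub>F r in sequentially. m_le k r \<ge> 1 / 6 * real r powr (- 1 - 4 / real k) * ln (real r) powr (1 / real k)"
    using prime_in_window[OF ab] eventually_ge_at_top[of "3::nat"]
  proof eventually_elim
    case (elim r)
    then obtain q where q: "prime q" "8 * real r powr a < real q" "real q \<le> real r powr b / ln (real r)"
      by blast
    \<comment> \<open>The least \<open>h\<close> with r \<le> 2^h, so that the third key component
      costs only a factor O(log r).\<close>
    define h where "h = nat \<lceil>log 2 (real r)\<rceil>"
    have r: "real r \<ge> 3" using elim(2) by simp
    have ln: "ln (real r) \<ge> 1"
      using ln_mono[of "exp 1" "real r"] exp_le r by simp
    have "real r powr 1 \<le> real r powr a" using ab r by (intro powr_mono) auto
    then have q8: "8 * real r \<le> real q" using q(2) r by simp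
    then have "8 * r \<le> q" by linarith
    moreover have "8 * r ^ (t + 1) \<le> q ^ t"
    proof -
      have "8 * real r ^ (t + 1) = 8 ^ 1 * real r powr (real (t + 1))"
        using r by (subst powr_realpow) auto
      also have "real (t + 1) = a * real t" using t(2) by (simp add: a_def field_simps)
      \<comment> \<open>Enlarging 8 to 8^t lets the constant enter the \<open>t\<close>-th power of
        8 r^a, the lower end of the window.\<close>
      also have "(8::real) ^ 1 * real r powr (a * real t) \<le> 8 ^ t * real r powr (a * real t)"
        using t(2) by (intro mult_right_mono power_increasing) auto
      also have "real r powr (a * real t) = (real r powr a) ^ t"
        using r by (simp add: powr_powr[symmetric] powr_realpow)
      also have "8 ^ t * (real r powr a) ^ t = (8 * real r powr a) ^ t" by (simp add: power_mult_distrib)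
      also have "\<dots> \<le> real q ^ t" using q(2) by (intro power_mono) auto
      finally have "real (8 * r ^ (t + 1)) \<le> real (q ^ t)" by simp
      then show ?thesis by (simp only: of_nat_le_iff)
    qed
    moreover have log: "log 2 (real r) \<ge> 1" using r by (simp add: le_log_iff)
    then have h: "h > 0" "log 2 (real r) \<le> real h" "real h \<le> log 2 (real r) + 1"
      unfolding h_def by linarith+
    moreover have "r \<le> 2 ^ h"
    proof -
      have "real r = 2 powr (log 2 (real r))" using r by simp
      also have "\<dots> \<le> 2 powr (real h)" using h by (intro powr_mono) auto
      also have "\<dots> = real (2 ^ h)" by (simp add: powr_realpow)
      finally show ?thesis by (simp only: of_nat_le_iff)
    qed
    moreover have "q > 2" using q8 r by linarith
    ultimately have m: "real r / (2 * (real q)\<^sup>2 * real h) \<le> m_le k r"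
      using q(1) t(1) by (intro m_le_ge[where t = t]) auto
    have "log 2 (real r) \<le> 2 * ln (real r)"
    proof -
      have "ln (2::real) \<ge> 1 / 2" using ln2_ge_two_thirds by simp
      then have "ln (real r) * 1 \<le> ln (real r) * (2 * ln 2)" using ln by (intro mult_left_mono) auto
      then show ?thesis by (simp add: log_def divide_le_eq mult_ac)
    qed
    then have hl: "real h \<le> 3 * ln (real r)" using h ln by linarith
    have "(real q)\<^sup>2 \<le> (real r powr b / ln (real r))\<^sup>2" using q(3) by (intro power_mono) auto
    then have "2 * (real q)\<^sup>2 * real h \<le> 2 * (real r powr b / ln (real r))\<^sup>2 * (3 * ln (real r))"
      using hl by (intro mult_mono) auto
    \<comment> \<open>The square of \<open>q\<close> saves two logarithms and \<open>h\<close> costs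
      one, so the density keeps one full factor ln r.\<close>
    also have "\<dots> = 6 * real r powr (2 * b) / ln (real r)"
      using ln r by (simp add: power2_eq_square field_simps powr_add[symmetric])
    finally have "real r / (6 * real r powr (2 * b) / ln (real r)) \<le> real r / (2 * (real q)\<^sup>2 * real h)"
      using q(1) h(1) prime_gt_0_nat[OF q(1)] ln r by (intro divide_left_mono mult_pos_pos divide_pos_pos) auto
    also have "real r / (6 * real r powr (2 * b) / ln (real r)) = 1 / 6 * (real r powr 1 / real r powr (2 * b)) * ln (real r)"
      using r by simp
    also have "real r powr 1 / real r powr (2 * b) = real r powr (- 1 - 4 / real k)"
      unfolding powr_diff[symmetric] by (simp add: b_def)
    finally have "1 / 6 * real r powr (- 1 - 4 / real k) * ln (real r) \<le> m_le k r"
      using m by (rule order_trans)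
    \<comment> \<open>Since ln r is at least 1, its first power dominates the power 1/k in the
      claim.\<close>
    moreover have "ln (real r) powr (1 / real k) \<le> ln (real r) powr 1"
      using ln assms by (intro powr_mono) auto
    then have "1 / 6 * real r powr (- 1 - 4 / real k) * ln (real r) powr (1 / real k)
        \<le> 1 / 6 * real r powr (- 1 - 4 / real k) * ln (real r)"
      using ln by (intro mult_left_mono) auto
    ultimately show ?case by linarith
  qed
  then obtain r0 where "\<forall>r\<ge>r0. m_le k r \<ge> 1 / 6 * real r powr (- 1 - 4 / real k) * ln (real r) powr (1 / real k)"
    by (auto simp: eventually_sequentially)
  then show ?thesis by (intro exI[of _ "1 / 6"]) auto
qed

end
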